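(* Assume the setting and notation described in the context, and assume moreover that $N=2$, $t=e-1\geq 2$, $e\mid (q^{m/2}-1)$ and $2\mid a$. Then $\mathcal{C}_{(a_1,\ldots,a_t)}$ is an $[n,tm]$ cyclic code over $\mathbb{F}_q$ with minimal Hamming distance $d=\frac{2(q-1)(r-\sqrt{r})}{(t+1)q\delta}$, and it has at most $\frac{1}{2}(t^2+5t-2)$ distinct nonzero weights. Its weight distribution is as follows. The weight $0$ occurs once. For integers $1\le k\le t$ and $0\le u\le k+1$ put $$F_{k,u}=\frac{r-1}{r\,2^{k+2}}\binom{t+1}{k+1}\binom{k+1}{u}\Big\{2(r-1)^k-(-1)^k\big[(1+\sqrt r)^u(1-\sqrt r)^{k+1-u}+(1-\sqrt r)^u(1+\sqrt r)^{k+1-u}\big]\Big\}.$$ (i) If $q\equiv 1\pmod 4$, put $W_{k,u}=\frac{q-1}{(t+1)q\delta}\{(k+1)r-(k+1-2u)\sqrt r\}$. (ii) If $q\equiv 3\pmod 4$, put $W_{k,u}=\frac{q-1}{(t+1)q\delta}\{(k+1)r-(-1)^{m/2}(k+1-2u)\sqrt r\}$. In either case, for every $w>0$ the number of codewords of Hamming weight $w$ equals $\sum F_{k,u}$, the sum running over all pairs $(k,u)$ with $1\le k\le t$, $0\le u\le k+1$ and $W_{k,u}=w$.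
   Context: Let $p$ be a prime, $s,m\ge 1$ integers, $q=p^s$, $r=q^m$, and let $\gamma$ be a generator of $\mathbb{F}_r^*$. Let $e\ge t\ge 2$ be integers with $e\mid(r-1)$, let $a$ be an integer with $a\not\equiv 0\pmod{r-1}$, and let $\Delta_1,\ldots,\Delta_t$ be integers, pairwise incongruent modulo $e$, with $\gcd(\Delta_2-\Delta_1,\ldots,\Delta_t-\Delta_1,e)=1$. Let $a_i\equiv a+\frac{r-1}{e}\Delta_i\pmod{r-1}$ for $1\le i\le t$. Assume that the minimal polynomials $h_{a_i}(x)$ of $\gamma^{-a_i}$ over $\mathbb{F}_q$ all have degree $m$ and are pairwise distinct. Put $N=\gcd\!\left(\frac{r-1}{q-1},ae\right)$, $\delta=\gcd(r-1,a_1,\ldots,a_t)$ and $n=\frac{r-1}{\delta}$. The code is $$\mathcal{C}_{(a_1,\ldots,a_t)}=\left\{\left(\mathrm{Tr}_{r/q}\Big(\sum_{j=1}^t x_j\gamma^{a_j i}\Big)\right)_{i=0}^{n-1} : x_1,\ldots,x_t\in\mathbb{F}_r\right\},$$ where $\mathrm{Tr}_{r/q}$ is the trace map from $\mathbb{F}_r$ to $\mathbb{F}_q$. The codewords are counted as the $r^t$ tuples $(x_1,\dots,x_t)$ (the code has dimension $tm$, so this is a bijection). *)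

theory Defs
  imports
    Complex_Main
    "HOL-Library.Cardinality"
    "HOL-Library.FuncSet"
    "HOL-Library.Function_Algebras"
    "HOL-Computational_Algebra.Polynomial"
    "HOL-Number_Theory.Cong"
begin

text \<open>
  An extension of fields is given by an embedding \<open>\<iota>\<close> of the type \<open>'q\<close> of the small field
  into the type \<open>'r\<close> of the large one.
\<close>

definition field_embedding :: "('q::field \<Rightarrow> 'r::field) \<Rightarrow> bool" where
  "field_embedding \<iota> \<longleftrightarrow>
     \<iota> 1 = 1 \<and> (\<forall>x y. \<iota> (x + y) = \<iota> x + \<iota> y) \<and> (\<forall>x y. \<iota> (x * y) = \<iota> x * \<iota> y)"

definition generates_units :: "'r::field \<Rightarrow> bool" where
  "generates_units \<gamma> \<longleftrightarrow> range (\<lambda>i::int. \<gamma> powi i) = UNIV - {0}"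

text \<open>
  The trace of an extension of degree \<open>m\<close>; its value is pulled back along \<open>\<iota>\<close>, so that it
  really lies in the small field.
\<close>

definition field_trace :: "('q::{field,finite} \<Rightarrow> 'r::field) \<Rightarrow> nat \<Rightarrow> 'r \<Rightarrow> 'q" where
  "field_trace \<iota> m x = (THE y. \<iota> y = (\<Sum>i<m. x ^ (CARD('q) ^ i)))"

definition minimal_poly :: "('q::field \<Rightarrow> 'r::field) \<Rightarrow> 'r \<Rightarrow> 'q poly" where
  "minimal_poly \<iota> x =
     (THE f. lead_coeff f = 1 \<and> poly (map_poly \<iota> f) x = 0 \<and>
        (\<forall>g. g \<noteq> 0 \<and> poly (map_poly \<iota> g) x = 0 \<longrightarrow> degree f \<le> degree g))"

text \<open>
  A word of length \<open>n\<close> is a function on \<open>nat\<close> that vanishes outside \<open>{..<n}\<close>.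
\<close>

definition scale_word :: "'q::field \<Rightarrow> (nat \<Rightarrow> 'q) \<Rightarrow> nat \<Rightarrow> 'q" where
  "scale_word c v = (\<lambda>i. c * v i)"

global_interpretation word_space: vector_space "scale_word :: 'q::field \<Rightarrow> (nat \<Rightarrow> 'q) \<Rightarrow> nat \<Rightarrow> 'q"
  by unfold_locales (auto simp: scale_word_def fun_eq_iff algebra_simps)

definition words :: "nat \<Rightarrow> (nat \<Rightarrow> 'q::field) set" where
  "words n = {v. \<forall>i\<ge>n. v i = 0}"

definition linear_code :: "nat \<Rightarrow> nat \<Rightarrow> (nat \<Rightarrow> 'q::field) set \<Rightarrow> bool" where
  "linear_code n k C \<longleftrightarrow> C \<subseteq> words n \<and> word_space.subspace C \<and> word_space.dim C = k"

definition cyclic_shift :: "nat \<Rightarrow> (nat \<Rightarrow> 'q::field) \<Rightarrow> nat \<Rightarrow> 'q" where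
  "cyclic_shift n v = (\<lambda>i. if i < n then v ((i + n - 1) mod n) else 0)"

definition cyclic_code :: "nat \<Rightarrow> nat \<Rightarrow> (nat \<Rightarrow> 'q::field) set \<Rightarrow> bool" where
  "cyclic_code n k C \<longleftrightarrow> linear_code n k C \<and> (\<forall>c\<in>C. cyclic_shift n c \<in> C)"

definition hamming_weight :: "nat \<Rightarrow> (nat \<Rightarrow> 'q::field) \<Rightarrow> nat" where
  "hamming_weight n v = card {i. i < n \<and> v i \<noteq> 0}"

definition hamming_dist :: "nat \<Rightarrow> (nat \<Rightarrow> 'q::field) \<Rightarrow> (nat \<Rightarrow> 'q) \<Rightarrow> nat" where
  "hamming_dist n v w = card {i. i < n \<and> v i \<noteq> w i}"

definition min_distance :: "nat \<Rightarrow> (nat \<Rightarrow> 'q::field) set \<Rightarrow> nat" where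
  "min_distance n C = Inf {hamming_dist n v w | v w. v \<in> C \<and> w \<in> C \<and> v \<noteq> w}"

definition tuples :: "nat \<Rightarrow> (nat \<Rightarrow> 'r) set" where
  "tuples t = {1..t} \<rightarrow>\<^sub>E UNIV"

definition codeword ::
  "('q::{field,finite} \<Rightarrow> 'r::field) \<Rightarrow> nat \<Rightarrow> 'r \<Rightarrow> nat \<Rightarrow> nat \<Rightarrow> (nat \<Rightarrow> int) \<Rightarrow> (nat \<Rightarrow> 'r) \<Rightarrow> nat \<Rightarrow> 'q"
where
  "codeword \<iota> m \<gamma> n t as x =
     (\<lambda>i. if i < n then field_trace \<iota> m (\<Sum>j=1..t. x j * \<gamma> powi (as j * int i)) else 0)"

definition trace_code ::
  "('q::{field,finite} \<Rightarrow> 'r::field) \<Rightarrow> nat \<Rightarrow> 'r \<Rightarrow> nat \<Rightarrow> nat \<Rightarrow> (nat \<Rightarrow> int) \<Rightarrow> (nat \<Rightarrow> 'q) set"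
where
  "trace_code \<iota> m \<gamma> n t as = codeword \<iota> m \<gamma> n t as ` tuples t"

definition freq :: "nat \<Rightarrow> nat \<Rightarrow> nat \<Rightarrow> nat \<Rightarrow> real" where
  "freq r t k u =
     (real r - 1) / (real r * 2 ^ (k + 2)) * real ((t + 1) choose (k + 1)) * real ((k + 1) choose u) *
     (2 * (real r - 1) ^ k
      - (-1) ^ k * ((1 + sqrt (real r)) ^ u * (1 - sqrt (real r)) ^ (k + 1 - u)
                    + (1 - sqrt (real r)) ^ u * (1 + sqrt (real r)) ^ (k + 1 - u)))"

text \<open>The two cases are \<open>q mod 4 = 1\<close> and \<open>q mod 4 = 3\<close>.\<close>

definition weight1 :: "nat \<Rightarrow> nat \<Rightarrow> nat \<Rightarrow> nat \<Rightarrow> nat \<Rightarrow> nat \<Rightarrow> real" where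
  "weight1 q r t \<delta> k u =
     (real q - 1) / ((real t + 1) * real q * real \<delta>) *
     ((real k + 1) * real r - (real k + 1 - 2 * real u) * sqrt (real r))"

definition weight3 :: "nat \<Rightarrow> nat \<Rightarrow> nat \<Rightarrow> nat \<Rightarrow> nat \<Rightarrow> nat \<Rightarrow> nat \<Rightarrow> real" where
  "weight3 q m r t \<delta> k u =
     (real q - 1) / ((real t + 1) * real q * real \<delta>) *
     ((real k + 1) * real r - (-1) ^ (m div 2) * (real k + 1 - 2 * real u) * sqrt (real r))"

end

theory Submission
  imports Defs
begin

text \<open>
  Write \<open>\<eta>\<close> for the quadratic character of the large field, \<open>R\<close> for the order of that field and
  \<open>\<beta> = \<gamma> powi ((R - 1) div e)\<close>. Splitting the positions \<open>i\<close> of a codeword by their residue \<open>h\<close>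
  modulo \<open>e\<close>, the entry at \<open>i\<close> is the trace of \<open>\<gamma> powi (a * i) * y h\<close>, where
  \<open>y h = (\<Sum>j. x j * \<beta> powi (\<Delta> j * h))\<close>. As \<open>N = 2\<close>, averaging over the positions in one residue
  class amounts to averaging over the nonzero squares, so the weight is a sum over \<open>h\<close> of terms
  depending only on \<open>\<eta> (y h)\<close>, and these terms are found from the sum of \<open>\<eta>\<close> over the kernel of the
  trace. The square of that sum follows from the correlation \<open>\<Sum>z. \<eta> z * \<eta> (d - z)\<close>; its sign is
  irrelevant, because the weight distribution is invariant under \<open>u \<mapsto> k + 1 - u\<close>. Finally
  \<open>t = e - 1\<close> frequencies are used out of \<open>e\<close>, so after multiplication with squares the vectors
  \<open>y\<close> run through the hyperplane of zero-sum vectors, in which the vectors with prescribed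
  quadratic characters are counted by induction on the number of coordinates.
\<close>

section \<open>Sums of periodic functions\<close>

text \<open>An injective map of a finite set into itself is onto, so \<open>g\<close> permutes the
  residues modulo \<open>M\<close>; translations and multiplications by units are the instances
  used.\<close>

lemma sum_periodic_reindex:
  fixes F :: "int \<Rightarrow> 'a::comm_monoid_add"
  assumes "M > 0" and per: "\<And>i. F (i mod M) = F i"
    and inj: "inj_on (\<lambda>i. g i mod M) {0..<M}"
  shows "(\<Sum>i\<in>{0..<M}. F (g i)) = (\<Sum>i\<in>{0..<M}. F i)"
proof -
  have "(\<lambda>i. g i mod M) ` {0..<M} = {0..<M}"
    by (rule endo_inj_surj) (use \<open>M > 0\<close> inj in auto)
  then have "(\<Sum>i\<in>{0..<M}. F i) = (\<Sum>i\<in>{0..<M}. F (g i mod M))"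
    using sum.reindex[OF inj, of F] by simp
  then show ?thesis by (simp add: per)
qed

lemma dvd_diff_interval:
  fixes i j :: int
  assumes "M dvd i - j" "0 \<le> i" "i < M" "0 \<le> j" "j < M"
  shows "i = j"
  using assms by (simp add: mod_eq_dvd_iff[symmetric])

lemma sum_periodic_shift:
  fixes F :: "int \<Rightarrow> 'a::comm_monoid_add"
  assumes "M > 0" and per: "\<And>i. F (i mod M) = F i"
  shows "(\<Sum>i\<in>{0..<M}. F (i + d)) = (\<Sum>i\<in>{0..<M}. F i)"
proof (rule sum_periodic_reindex[where F = F, OF assms])
  have "i = j" if "(i + d) mod M = (j + d) mod M" "i \<in> {0..<M}" "j \<in> {0..<M}" for i j
  proof -
    have "M dvd i - j" using that(1) by (simp add: mod_eq_dvd_iff)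
    then show ?thesis using that(2,3) by (auto dest: dvd_diff_interval)
  qed
  then show "inj_on (\<lambda>i. (i + d) mod M) {0..<M}" by (intro inj_onI) blast
qed

lemma sum_periodic_scale:
  fixes F :: "int \<Rightarrow> 'a::comm_monoid_add"
  assumes "M > 0" and per: "\<And>i. F (i mod M) = F i" and cop: "coprime b M"
  shows "(\<Sum>i\<in>{0..<M}. F (b * i)) = (\<Sum>i\<in>{0..<M}. F i)"
proof (rule sum_periodic_reindex[where F = F, OF assms(1,2)])
  have "i = j" if "(b * i) mod M = (b * j) mod M" "i \<in> {0..<M}" "j \<in> {0..<M}" for i j
  proof -
    have "M dvd b * (i - j)" using that(1) by (simp add: mod_eq_dvd_iff algebra_simps)
    then have "M dvd i - j" using cop by (simp add: coprime_commute coprime_dvd_mult_right_iff)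
    then show ?thesis using that(2,3) by (auto dest: dvd_diff_interval)
  qed
  then show "inj_on (\<lambda>i. b * i mod M) {0..<M}" by (intro inj_onI) blast
qed

lemma sum_periodic_multiple:
  fixes F :: "int \<Rightarrow> real"
  assumes "M > 0" and per: "\<And>i. F (i mod M) = F i"
  shows "(\<Sum>i\<in>{0..<M * int k}. F i) = real k * (\<Sum>i\<in>{0..<M}. F i)"
proof (induction k)
  case (Suc k)
  have split: "{0..<M * int (Suc k)} = {0..<M * int k} \<union> {M * int k..<M * int (Suc k)}"
    using \<open>M > 0\<close> by (intro ivl_disj_un_two(3)[symmetric]) (auto simp: algebra_simps)
  have "(\<Sum>i\<in>{M * int k..<M * int (Suc k)}. F i) = (\<Sum>i\<in>{0..<M}. F (i + M * int k))"
    by (rule sum.reindex_bij_witness[of _ "\<lambda>i. i + M * int k" "\<lambda>i. i - M * int k"])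
       (auto simp: algebra_simps)
  also have "\<dots> = (\<Sum>i\<in>{0..<M}. F i)"
    by (intro sum.cong refl) (metis mod_mult_self2 per)
  finally have "(\<Sum>i\<in>{0..<M * int (Suc k)}. F i) = (\<Sum>i\<in>{0..<M * int k}. F i) + (\<Sum>i\<in>{0..<M}. F i)"
    unfolding split by (subst sum.union_disjoint) auto
  with Suc show ?case by (simp add: algebra_simps)
qed simp

section \<open>Finite fields and the quadratic character\<close>

text \<open>Multiplication by \<open>x\<close> permutes the nonzero elements, and their product can
  be cancelled.\<close>

lemma power_card_field:
  fixes x :: "'a::{field,finite}"
  assumes "x \<noteq> 0"
  shows "x ^ (CARD('a) - 1) = 1"
proof -
  have "(\<Prod>y\<in>UNIV-{0}. x * y) = (\<Prod>y\<in>UNIV-{0::'a}. y)"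
    by (rule prod.reindex_bij_witness[of _ "\<lambda>y. y / x" "\<lambda>y. x * y"]) (use assms in auto)
  moreover have "(\<Prod>y\<in>UNIV-{0::'a}. y) \<noteq> 0" by simp
  ultimately show ?thesis by (simp add: prod.distrib card_Diff_singleton)
qed

lemma power_card_field_eq:
  fixes x :: "'a::{field,finite}"
  shows "x ^ CARD('a) = x"
proof (cases "x = 0")
  case False
  have "CARD('a) = Suc (CARD('a) - 1)" by simp
  then have "x ^ CARD('a) = x * x ^ (CARD('a) - 1)" by (metis power_Suc)
  then show ?thesis using power_card_field[OF False] by simp
qed simp

text \<open>Translation by 1 permutes the ring, yet adds \<open>CARD('a)\<close> ones to the sum of
  all elements.\<close>

lemma of_nat_CARD_eq_0: "of_nat CARD('a) = (0::'a::{ring_1,finite})"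
proof -
  have "(\<Sum>x\<in>UNIV. x + 1) = (\<Sum>x\<in>(UNIV::'a set). x)"
    by (rule sum.reindex_bij_witness[of _ "\<lambda>x. x - 1" "\<lambda>x. x + 1"]) auto
  then show ?thesis by (simp add: sum.distrib)
qed

lemma CHAR_prime_power_card:
  assumes "prime p" "CARD('a::{field,finite}) = p ^ k"
  shows "CHAR('a) = p"
proof -
  have "prime CHAR('a)"
    by (rule prime_CHAR_semidom) (simp add: finite_imp_CHAR_pos)
  moreover have "CHAR('a) dvd p ^ k"
    using of_nat_CARD_eq_0[where 'a='a] assms(2) of_nat_eq_0_iff_char_dvd by metis
  ultimately show ?thesis
    using assms(1) prime_dvd_power primes_dvd_imp_eq by blast
qed

definition quad_char :: "'r::field \<Rightarrow> real" where
  "quad_char z = (if z = 0 then 0 else if \<exists>y. z = y ^ 2 then 1 else -1)"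

lemma quad_char_0 [simp]: "quad_char 0 = 0"
  by (simp add: quad_char_def)

lemma quad_char_cases: "z \<noteq> 0 \<Longrightarrow> quad_char z = 1 \<or> quad_char z = -1"
  by (simp add: quad_char_def)

lemma quad_char_eq_0_iff [simp]: "quad_char z = 0 \<longleftrightarrow> z = 0"
  by (simp add: quad_char_def)

lemma quad_char_square: "y \<noteq> 0 \<Longrightarrow> quad_char (y ^ 2) = 1"
  by (auto simp: quad_char_def)

text \<open>\<open>card_mod4\<close> makes -1 a square, so that the quadratic character is even; it
  also excludes characteristic 2.\<close>

locale field_generator =
  fixes \<gamma> :: "'r::{field,finite}" and M :: int
  assumes gen: "generates_units \<gamma>" and M_eq: "M = int (CARD('r) - 1)"
    and card_mod4: "4 dvd CARD('r) - 1"
begin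

section \<open>Discrete logarithms and the quadratic character\<close>

lemma gamma_nz [simp]: "\<gamma> \<noteq> 0"
proof
  assume "\<gamma> = 0"
  moreover have "\<gamma> powi 1 \<in> UNIV - {0}"
    using gen unfolding generates_units_def by (metis rangeI)
  ultimately show False by simp
qed

lemma card_gt1: "CARD('r) > 1"
  using card_mono[of UNIV "{0, 1::'r}"] by simp

lemma M_pos: "M > 0"
  using card_gt1 by (simp add: M_eq)

lemma M_even: "even M"
  using card_mod4 unfolding M_eq by (metis dvd_trans even_numeral even_of_nat)

lemma powi_M: "\<gamma> powi (M * i) = 1"
  unfolding M_eq power_int_mult power_int_of_nat power_card_field[OF gamma_nz] by simp

lemma powi_mod: "\<gamma> powi (i mod M) = \<gamma> powi i"
proof -
  have "\<gamma> powi i = \<gamma> powi (M * (i div M) + i mod M)" by simp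
  also have "\<dots> = \<gamma> powi (i mod M)"
    by (subst power_int_add) (simp_all add: powi_M)
  finally show ?thesis by simp
qed

text \<open>The exponents of one period already reach every nonzero element; as both sets have the
  same size, the map is injective too.\<close>

lemma gamma_bij: "bij_betw (\<lambda>i. \<gamma> powi i) {0..<M} (UNIV - {0})"
proof -
  have "(\<lambda>i. \<gamma> powi i) ` {0..<M} = UNIV - {0}"
  proof -
    have "y \<in> (\<lambda>i. \<gamma> powi i) ` {0..<M}" if "y \<noteq> 0" for y
    proof -
      have "y \<in> range (\<lambda>i. \<gamma> powi i)" using gen that by (simp add: generates_units_def)
      then obtain i where "y = \<gamma> powi i" by (rule rangeE)
      then have "y = \<gamma> powi (i mod M)" by (simp only: powi_mod)
      moreover have "i mod M \<in> {0..<M}" using M_pos by simp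
      ultimately show ?thesis by (rule image_eqI)
    qed
    moreover have "(\<lambda>i. \<gamma> powi i) ` {0..<M} \<subseteq> UNIV - {0}"
      by (simp add: image_subset_iff)
    ultimately show ?thesis by blast
  qed
  moreover have "card {0..<M} = card (UNIV - {0::'r})" by (simp add: M_eq card_Diff_singleton)
  ultimately show ?thesis
    by (simp add: bij_betw_def eq_card_imp_inj_on)
qed

lemma gamma_powE:
  assumes "y \<noteq> 0" obtains i where "y = \<gamma> powi i" "i \<in> {0..<M}"
proof -
  have "y \<in> (\<lambda>i. \<gamma> powi i) ` {0..<M}" using assms gamma_bij by (simp add: bij_betw_def)
  then show ?thesis using that by blast
qed

lemma powi_eq_1_iff: "\<gamma> powi i = 1 \<longleftrightarrow> M dvd i"
proof
  assume "\<gamma> powi i = 1"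
  then have "\<gamma> powi (i mod M) = \<gamma> powi 0" by (simp add: powi_mod)
  then have "i mod M = 0"
    by (rule inj_onD[OF bij_betw_imp_inj_on[OF gamma_bij]]) (use M_pos in auto)
  then show "M dvd i" by auto
qed (auto simp: powi_M)

lemma powi_eq_iff: "\<gamma> powi i = \<gamma> powi j \<longleftrightarrow> M dvd i - j"
  using powi_eq_1_iff[of "i - j"] by (simp add: power_int_diff)

text \<open>The parity of an exponent is well defined because exponents matter only modulo
  \<open>M\<close>, which is even.\<close>

lemma quad_char_powi: "quad_char (\<gamma> powi i) = (if even i then 1 else -1)"
proof -
  have "(\<exists>y. \<gamma> powi i = y ^ 2) \<longleftrightarrow> even i"
  proof
    assume "\<exists>y. \<gamma> powi i = y ^ 2"
    then obtain y where y: "\<gamma> powi i = y ^ 2" by blast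
    then have "y \<noteq> 0" by (metis gamma_nz power_int_not_zero zero_power2)
    then obtain j where "y = \<gamma> powi j" by (rule gamma_powE)
    with y have "\<gamma> powi i = \<gamma> powi (j * 2)" by (simp add: power_int_mult)
    then have "M dvd i - j * 2" by (simp only: powi_eq_iff)
    then have "even (i - j * 2)" using M_even by (rule dvd_trans[rotated])
    then show "even i" by simp
  next
    assume "even i"
    then obtain j where "i = j * 2" by (metis dvd_def mult.commute)
    then have "\<gamma> powi i = (\<gamma> powi j) ^ 2" by (simp add: power_int_mult)
    then show "\<exists>y. \<gamma> powi i = y ^ 2" by blast
  qed
  then show ?thesis by (simp add: quad_char_def)
qed

lemma quad_char_mult: "quad_char (x * y :: 'r) = quad_char x * quad_char y"
proof (cases "x = 0 \<or> y = 0")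
  case False
  then obtain i j where "x = \<gamma> powi i" "y = \<gamma> powi j" by (metis gamma_powE)
  then show ?thesis by (simp add: quad_char_powi flip: power_int_add)
qed auto

text \<open>In characteristic 2 the even number \<open>CARD('r) - 1\<close> would vanish in the
  field, where it equals -1.\<close>

lemma two_nz: "(2::'r) \<noteq> 0"
proof
  assume "(2::'r) = 0"
  moreover have "of_nat (CARD('r) - 1) = (2::'r) * of_nat ((CARD('r) - 1) div 2)"
    using M_even unfolding M_eq by (metis dvd_mult_div_cancel even_of_nat of_nat_mult of_nat_numeral)
  ultimately have "of_nat (CARD('r) - 1) = (0::'r)" by simp
  then show False using of_nat_CARD_eq_0[where 'a='r] card_gt1
    by (metis add_0 le_add_diff_inverse2 less_imp_le_nat of_nat_1 of_nat_add zero_neq_one)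
qed

text \<open>\<open>\<gamma> powi (M div 2)\<close> squares to 1 without being 1, so it is -1; its
  exponent is even as 4 divides \<open>M\<close>.\<close>

lemma quad_char_minus_1: "quad_char (- 1 :: 'r) = 1"
proof -
  obtain c where c: "CARD('r) - 1 = 4 * c" using card_mod4 by (rule dvdE)
  define x where "x = \<gamma> powi (int (2 * c))"
  have "x ^ 2 = \<gamma> powi (M * 1)" unfolding x_def M_eq c
    by (simp add: power_int_power' algebra_simps del: power_int_of_nat)
  then have "x ^ 2 = 1" by (simp add: powi_M del: mult_1_right)
  moreover have "x \<noteq> 1" unfolding x_def using c card_gt1
    by (subst powi_eq_1_iff) (auto simp: M_eq dest: zdvd_imp_le)
  ultimately have "x = - 1" by (simp add: power2_eq_1_iff)
  then show ?thesis using quad_char_powi[of "int (2 * c)"] by (simp add: x_def)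
qed

lemma quad_char_minus: "quad_char (- x :: 'r) = quad_char x"
  using quad_char_mult[of "-1" x] quad_char_minus_1 by simp

lemma quad_char_inverse: "quad_char (inverse x :: 'r) = quad_char x"
proof (cases "x = 0")
  case False
  then have "quad_char x * quad_char (inverse x) = 1"
    using quad_char_square[of "1::'r"] quad_char_mult[of x "inverse x"] by simp
  then show ?thesis using quad_char_cases[OF False] by auto
qed simp

section \<open>Sums of the quadratic character\<close>

lemma sum_quad_char: "(\<Sum>x\<in>(UNIV::'r set). quad_char x) = 0"
proof -
  have "(\<Sum>x\<in>(UNIV::'r set). quad_char x) = (\<Sum>x\<in>UNIV. quad_char (\<gamma> * x))"
    by (rule sum.reindex_bij_witness[of _ "\<lambda>x. \<gamma> * x" "\<lambda>x. x / \<gamma>"]) auto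
  moreover have "quad_char \<gamma> = -1" using quad_char_powi[of 1] by simp
  ultimately show ?thesis by (simp add: quad_char_mult sum_negf)
qed

text \<open>For nonzero \<open>d\<close> and \<open>x\<close> the product is
  \<open>quad_char (d / x - 1)\<close>, since the character agrees at \<open>x\<close> and its
  inverse; \<open>d / x - 1\<close> takes every value but -1 exactly once. For \<open>d = 0\<close>
  evenness makes each term with \<open>x \<noteq> 0\<close> equal to 1.\<close>

lemma sum_quad_char_convolution:
  "(\<Sum>x\<in>UNIV. quad_char x * quad_char (d - x)) = (if d = (0::'r) then real CARD('r) else 0) - 1"
proof (cases "d = 0")
  case True
  have "quad_char x * quad_char (d - x) = (if x = 0 then 0 else 1)" for x :: 'r
    using quad_char_cases[of x] True by (auto simp: quad_char_minus)
  moreover have "card (UNIV - {0::'r}) = CARD('r) - 1" by (simp add: card_Diff_singleton)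
  moreover have "UNIV \<inter> {x. x \<noteq> (0::'r)} = UNIV - {0}" by auto
  ultimately show ?thesis using True card_gt1 by (simp add: sum.If_cases Compl_eq_Diff_UNIV of_nat_diff)
next
  case False
  have "quad_char x * quad_char (d - x) = quad_char (d / x - 1)" if "x \<noteq> 0" for x :: 'r
  proof -
    have "quad_char x * quad_char (d - x) = quad_char (inverse x * (d - x))"
      by (simp add: quad_char_mult quad_char_inverse)
    also have "inverse x * (d - x) = d / x - 1" using that by (simp add: field_simps)
    finally show ?thesis .
  qed
  then have "(\<Sum>x\<in>UNIV. quad_char x * quad_char (d - x)) = (\<Sum>x\<in>UNIV-{0}. quad_char (d / x - 1))"
    by (intro sum.mono_neutral_cong_right) auto
  also have "\<dots> = (\<Sum>y\<in>UNIV-{-1::'r}. quad_char y)"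
    by (rule sum.reindex_bij_witness[of _ "\<lambda>y. d / (y + 1)" "\<lambda>x. d / x - 1"])
       (use False in \<open>auto simp: field_simps eq_neg_iff_add_eq_0\<close>)
  also have "\<dots> = (\<Sum>y\<in>(UNIV::'r set). quad_char y) - quad_char (-1::'r)"
    by (simp add: sum_diff1)
  finally show ?thesis using False by (simp add: sum_quad_char quad_char_minus_1)
qed

text \<open>A nonzero \<open>s\<close> has \<open>1 + quad_char s\<close> square roots: two, namely
  \<open>y\<close> and \<open>- y\<close>, or none.\<close>

lemma sum_squares_eq:
  fixes g :: "'r \<Rightarrow> real"
  shows "(\<Sum>y\<in>UNIV-{0}. g (y ^ 2)) = (\<Sum>s\<in>UNIV-{0}. (1 + quad_char s) * g s)"
proof -
  have "(\<Sum>s\<in>UNIV-{0}. \<Sum>y\<in>{y\<in>UNIV-{0}. y ^ 2 = s}. g (y ^ 2)) = (\<Sum>y\<in>UNIV-{0}. g (y ^ 2))"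
    by (rule sum.group) auto
  moreover have "(\<Sum>y\<in>{y\<in>UNIV-{0}. y ^ 2 = s}. g (y ^ 2)) = (1 + quad_char s) * g s" if "s \<noteq> 0" for s
  proof (cases "\<exists>y. s = y ^ 2")
    case True
    then obtain y where y: "s = y ^ 2" by blast
    with that have "y \<noteq> 0" by auto
    moreover have "y \<noteq> - y" using \<open>y \<noteq> 0\<close> two_nz by (simp add: eq_neg_iff_add_eq_0 flip: mult_2)
    moreover have "{z\<in>UNIV-{0}. z ^ 2 = s} = {y, - y}"
      using \<open>y \<noteq> 0\<close> by (auto simp: y power2_eq_iff)
    ultimately show ?thesis by (simp add: y quad_char_square)
  next
    case False
    then have "{z\<in>UNIV-{0}. z ^ 2 = s} = {}" by auto
    then show ?thesis using False that by (simp only: quad_char_def) simp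
  qed
  ultimately show ?thesis by (metis (no_types, lifting) DiffE singletonI sum.cong)
qed

end

section \<open>Sums of elements with prescribed quadratic character\<close>

text \<open>Splitting off the coordinate \<open>h\<close> turns the count into a convolution with
  the indicator function of \<open>T h\<close>; this recursion drives the induction on the number of
  coordinates.\<close>

lemma card_PiE_insert_sum:
  fixes T :: "'i \<Rightarrow> 'a::{ab_group_add,finite} set"
  assumes "finite J" "h \<notin> J"
  shows "card {z \<in> PiE (insert h J) T. sum z (insert h J) = c}
       = (\<Sum>s\<in>T h. card {z \<in> PiE J T. sum z J = c - s})"
proof -
  let ?S = "SIGMA s:T h. {z \<in> PiE J T. sum z J = c - s}"
  have sum_upd: "(\<Sum>x\<in>J. if x = h then s else g x) = sum g J" for g :: "'i \<Rightarrow> 'a" and s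
    using assms(2) by (intro sum.cong) auto
  have image_filter: "{z \<in> f ` X. P z} = f ` {x \<in> X. P (f x)}"
    for f :: "'a \<times> ('i \<Rightarrow> 'a) \<Rightarrow> 'i \<Rightarrow> 'a" and X P
    by blast
  have "{x \<in> T h \<times> PiE J T. sum ((\<lambda>(y, g). g(h := y)) x) (insert h J) = c} = ?S"
    using assms by (auto simp: sum_upd eq_diff_eq add.commute)
  then have "{z \<in> PiE (insert h J) T. sum z (insert h J) = c} = (\<lambda>(y, g). g(h := y)) ` ?S"
    unfolding PiE_insert_eq image_filter by simp
  moreover have "inj_on (\<lambda>(y, g). g(h := y)) ?S"
    by (rule inj_on_subset[OF inj_combinator[OF assms(2), of T]]) auto
  ultimately show ?thesis
    using assms by (simp add: card_image card_SigmaI finite_PiE)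
qed

text \<open>For \<open>\<theta> = 1\<close> and \<open>\<theta> = -1\<close> these are the two
  quadratic Gaussian periods of a field of order \<open>R\<close> with
  \<open>R mod 4 = 1\<close>.\<close>

definition quad_period :: "real \<Rightarrow> real \<Rightarrow> real" where
  "quad_period R \<theta> = (- 1 + \<theta> * sqrt R) / 2"

context field_generator
begin

text \<open>For \<open>\<theta> = \<plusminus>1\<close>, \<open>psi \<theta>\<close> is a sum of nontrivial additive characters over one class of
  nonzero elements modulo squares. Convolution with the indicator function of the class \<open>\<tau>\<close> has
  the eigenfunctions \<open>1\<close> and \<open>psi \<theta>\<close>, the latter with eigenvalue \<open>quad_period R (\<theta> * \<tau>)\<close>; in this
  form no character is needed.\<close>

definition psi :: "real \<Rightarrow> 'r \<Rightarrow> real" where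
  "psi \<theta> c = (if c = 0 then real CARD('r) / 2 else 0) - 1 / 2
             + \<theta> * quad_char c * sqrt (real CARD('r)) / 2"

lemma quad_class_indicator:
  fixes s :: 'r
  assumes "\<tau> = 1 \<or> \<tau> = -1"
  shows "(if quad_char s = \<tau> then 1 else 0) = (1 - (if s = 0 then 1 else 0) + \<tau> * quad_char s) / 2"
  using assms quad_char_cases[of s] by (cases "s = 0") auto

lemma sum_quad_class:
  fixes f :: "'r \<Rightarrow> real"
  assumes "\<tau> = 1 \<or> \<tau> = -1"
  shows "(\<Sum>s | quad_char s = \<tau>. f s)
       = ((\<Sum>s\<in>UNIV. f s) - f 0 + \<tau> * (\<Sum>s\<in>UNIV. quad_char s * f s)) / 2"
proof -
  have "(\<Sum>s | quad_char s = \<tau>. f s) = (\<Sum>s\<in>UNIV. (if quad_char s = \<tau> then 1 else 0) * f s)"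
    by (simp add: sum.If_cases if_distrib[of "\<lambda>x. x * _"] cong: if_cong)
  also have "\<dots> = (\<Sum>s\<in>UNIV. (f s - (if s = 0 then f 0 else 0) + \<tau> * (quad_char s * f s)) / 2)"
    unfolding quad_class_indicator[OF assms] by (intro sum.cong) (auto simp: algebra_simps)
  also have "\<dots> = ((\<Sum>s\<in>UNIV. f s) - f 0 + \<tau> * (\<Sum>s\<in>UNIV. quad_char s * f s)) / 2"
    by (simp add: sum.distrib sum_subtractf sum_distrib_left flip: sum_divide_distrib)
  finally show ?thesis .
qed

lemma card_quad_class:
  assumes "\<tau> = 1 \<or> \<tau> = -1"
  shows "real (card {s::'r. quad_char s = \<tau>}) = (real CARD('r) - 1) / 2"
  using sum_quad_class[OF assms, of "\<lambda>_. 1"] by (simp add: sum_quad_char)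

text \<open>Expanding the class indicator by \<open>sum_quad_class\<close> leaves the total of
  \<open>psi \<theta>\<close>, which is 0, the single value \<open>psi \<theta> c\<close>, and the
  correlation with \<open>quad_char\<close>, which \<open>sum_quad_char_convolution\<close> shows to
  be a multiple of \<open>psi \<theta> c\<close> again.\<close>

lemma psi_convolution:
  assumes "\<tau> = 1 \<or> \<tau> = -1" "\<theta> = 1 \<or> \<theta> = -1"
  shows "(\<Sum>s | quad_char s = \<tau>. psi \<theta> (c - s)) = quad_period (real CARD('r)) (\<theta> * \<tau>) * psi \<theta> c"
proof -
  let ?R = "real CARD('r)"
  have reflect: "(\<Sum>s\<in>UNIV. quad_char (c - s)) = 0"
  proof -
    have "(\<Sum>s\<in>UNIV. quad_char (c - s)) = (\<Sum>s\<in>UNIV. quad_char (s::'r))"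
      by (rule sum.reindex_bij_witness[of _ "\<lambda>s. c - s" "\<lambda>s. c - s"]) auto
    then show ?thesis by (simp add: sum_quad_char)
  qed
  define k where "k = \<theta> * sqrt ?R / 2"
  have split: "psi \<theta> (c - s) = (if s = c then ?R / 2 else 0) - 1 / 2
      + k * quad_char (c - s)" for s
    by (simp add: psi_def k_def)
  have s1: "(\<Sum>s\<in>UNIV. psi \<theta> (c - s)) = 0"
    unfolding split by (simp add: sum.distrib sum_subtractf reflect flip: sum_distrib_left)
  have "(\<Sum>s\<in>UNIV. quad_char s * psi \<theta> (c - s))
      = (\<Sum>s\<in>UNIV. (if s = c then ?R / 2 * quad_char c else 0) - 1 / 2 * quad_char s
      + k * (quad_char s * quad_char (c - s)))"
    unfolding split by (intro sum.cong) (auto simp: algebra_simps)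
  also have "\<dots> = ?R / 2 * quad_char c
      + k * ((if c = 0 then ?R else 0) - 1)"
    by (simp add: sum.distrib sum_subtractf sum_quad_char sum_quad_char_convolution
        flip: sum_distrib_left sum_divide_distrib)
  finally have s2: "(\<Sum>s\<in>UNIV. quad_char s * psi \<theta> (c - s)) = \<dots>" .
  have sq: "sqrt ?R * sqrt ?R = ?R" by simp
  \<comment> \<open>Only \<open>\<theta> * \<theta> = 1\<close> is involved; \<open>Q\<close>,
    \<open>x\<close> and \<open>w\<close> abstract from the square root, the character value and the
    delta term.\<close>
  have "\<tau> * (Q * Q / 2 * x + \<theta> * Q / 2 * (w - 1))
      = \<theta> * \<tau> * Q * (w / 2 - 1 / 2 + \<theta> * x * Q / 2)" for x w Q :: real
    using assms(2) by (auto simp: field_simps)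
  from this[of "sqrt ?R" "quad_char c" "if c = 0 then ?R else 0"]
  have key: "\<tau> * (?R / 2 * quad_char c + \<theta> * sqrt ?R / 2 * ((if c = 0 then ?R else 0) - 1))
      = \<theta> * \<tau> * sqrt ?R * psi \<theta> c"
    unfolding psi_def sq by (simp split: if_splits)
  show ?thesis
    unfolding sum_quad_class[OF assms(1)] s1 s2 k_def key quad_period_def by (simp add: field_simps)
qed

text \<open>The constant 1, \<open>psi 1\<close> and \<open>psi (-1)\<close> are simultaneous
  eigenfunctions of the convolutions with both classes, so each new coordinate multiplies the three
  coefficients by its eigenvalues.\<close>

lemma card_sums_of_quad_classes:
  assumes "finite J" "\<And>h. h \<in> J \<Longrightarrow> \<tau> h = 1 \<or> \<tau> h = -1"
  shows "real (card {z \<in> PiE J (\<lambda>h. {s::'r. quad_char s = \<tau> h}). sum z J = c})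
     = (((real CARD('r) - 1) / 2) ^ card J + (\<Prod>h\<in>J. quad_period (real CARD('r)) (\<tau> h)) * psi 1 c
        + (\<Prod>h\<in>J. quad_period (real CARD('r)) (- \<tau> h)) * psi (-1) c) / real CARD('r)"
  using assms
proof (induction J arbitrary: c rule: finite_induct)
  case empty
  \<comment> \<open>Only the empty vector is left, so the count is the delta function at 0, which is
    \<open>(1 + psi 1 c + psi (-1) c) / CARD('r)\<close>.\<close>
  have "{z. z = (\<lambda>x. undefined) \<and> c = 0} = (if c = 0 then {\<lambda>x. undefined} else {})" by auto
  then show ?case using card_gt1 by (simp add: psi_def)
next
  case (insert h J)
  let ?R = "real CARD('r)" and ?T = "\<lambda>h. {s::'r. quad_char s = \<tau> h}"
  have \<tau>: "\<tau> h = 1 \<or> \<tau> h = -1" using insert.prems by simp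
  have "real (card {z \<in> PiE (insert h J) ?T. sum z (insert h J) = c})
      = (\<Sum>s | quad_char s = \<tau> h. real (card {z \<in> PiE J ?T. sum z J = c - s}))"
    using insert by (subst card_PiE_insert_sum) simp_all
  also have "\<dots> = (\<Sum>s | quad_char s = \<tau> h. (((?R - 1) / 2) ^ card J
      + (\<Prod>h\<in>J. quad_period (real CARD('r)) (\<tau> h)) * psi 1 (c - s) + (\<Prod>h\<in>J. quad_period (real CARD('r)) (- \<tau> h)) * psi (-1) (c - s)) / ?R)"
    using insert by (intro sum.cong refl insert.IH) auto
  also have "\<dots> = ((?R - 1) / 2 * ((?R - 1) / 2) ^ card J
      + (\<Prod>h\<in>J. quad_period (real CARD('r)) (\<tau> h)) * (quad_period (real CARD('r)) (\<tau> h) * psi 1 c)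
      + (\<Prod>h\<in>J. quad_period (real CARD('r)) (- \<tau> h)) * (quad_period (real CARD('r)) (- \<tau> h) * psi (-1) c)) / ?R"
    using psi_convolution[OF \<tau>, of 1 c] psi_convolution[OF \<tau>, of "-1" c] card_quad_class[OF \<tau>]
    by (simp add: sum.distrib flip: sum_divide_distrib sum_distrib_left)
  finally show ?case using insert by (simp add: algebra_simps)
qed

end

section \<open>The trace and the quadratic character\<close>

text \<open>\<open>even_index\<close> concerns the index of the unit group of the small field in
  that of the large one; it makes every nonzero element of the small field a square in the large
  one.\<close>

locale field_extension = field_generator \<gamma> M
  for \<gamma> :: "'r::{field,finite}" and M :: int +
  fixes \<iota> :: "'q::{field,finite} \<Rightarrow> 'r" and p s m q :: nat
  assumes embed: "field_embedding \<iota>" and prime_p: "prime p"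
    and card_q: "CARD('q) = q" and q_eq: "q = p ^ s"
    and card_r: "CARD('r) = q ^ m" and m_pos: "m \<ge> 1"
    and even_index: "even ((CARD('r) - 1) div (q - 1))"
begin

section \<open>The embedding of the small field and the Frobenius map\<close>

lemma iota_1 [simp]: "\<iota> 1 = 1" and iota_add: "\<iota> (x + y) = \<iota> x + \<iota> y"
  and iota_mult: "\<iota> (x * y) = \<iota> x * \<iota> y"
  using embed by (auto simp: field_embedding_def)

lemma iota_0 [simp]: "\<iota> 0 = 0"
  using iota_add[of 0 0] by (metis add.right_neutral add_left_cancel)

lemma iota_minus: "\<iota> (- x) = - \<iota> x"
  using iota_add[of x "- x"] by (simp add: eq_neg_iff_add_eq_0 add.commute)

lemma iota_eq_0_iff [simp]: "\<iota> x = 0 \<longleftrightarrow> x = 0"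
proof
  assume "\<iota> x = 0"
  then show "x = 0" using iota_mult[of x "inverse x"] by (cases "x = 0") auto
qed simp

lemma iota_inj: "inj \<iota>"
proof (rule injI)
  fix x y assume "\<iota> x = \<iota> y"
  then have "\<iota> (x + - y) = 0" unfolding iota_add iota_minus by simp
  then show "x = y" by simp
qed

lemma iota_power: "\<iota> (x ^ k) = \<iota> x ^ k"
  by (induction k) (simp_all add: iota_mult)

lemma q_gt1: "q > 1"
  using card_mono[of UNIV "{0, 1::'q}"] by (simp add: card_q)

lemma iota_power_q: "\<iota> c ^ (q ^ i) = \<iota> c"
proof (induction i)
  case (Suc i)
  have "\<iota> c ^ (q ^ Suc i) = (\<iota> c ^ (q ^ i)) ^ q" by (simp add: mult.commute flip: power_mult)
  also have "\<dots> = \<iota> (c ^ CARD('q))" by (simp add: Suc iota_power card_q)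
  finally show ?case by (simp add: power_card_field_eq)
qed simp

lemma frobenius_add: "(x + y :: 'r) ^ (q ^ i) = x ^ (q ^ i) + y ^ (q ^ i)"
proof (rule freshmans_dream')
  have "CHAR('r) = p"
    by (rule CHAR_prime_power_card[where k = "s * m"])
       (simp_all add: prime_p card_r q_eq power_mult)
  then show "prime CHAR('r)" "q ^ i = CHAR('r) ^ (s * i)"
    by (simp_all add: prime_p q_eq power_mult)
qed

section \<open>The trace map and its kernel\<close>

definition T :: "'r \<Rightarrow> 'r" where "T x = (\<Sum>i<m. x ^ (q ^ i))"

lemma T_add: "T (x + y) = T x + T y"
  by (simp add: T_def frobenius_add sum.distrib)

lemma T_scale: "T (\<iota> c * x) = \<iota> c * T x"
  by (simp add: T_def power_mult_distrib iota_power_q sum_distrib_left)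

lemma T_0 [simp]: "T 0 = 0"
  using T_scale[of 0 0] by simp

lemma T_minus: "T (- x) = - T x"
  using T_scale[of "- 1" x] by (simp add: iota_minus)

lemma frobenius_sum: "(\<Sum>i\<in>I. f i :: 'r) ^ q = (\<Sum>i\<in>I. f i ^ q)"
proof (induction I rule: infinite_finite_induct)
  case (insert i I)
  then show ?case using frobenius_add[of "f i" "sum f I" 1] by simp
qed (use q_gt1 in \<open>auto simp: power_0_left\<close>)

text \<open>Raising to the power \<open>q\<close> moves each summand to the next one; the last
  returns to \<open>x\<close> because \<open>x ^ CARD('r) = x\<close>.\<close>

lemma T_power_q: "T x ^ q = T x"
proof -
  have "T x ^ q = (\<Sum>i<m. x ^ (q ^ Suc i))"
    by (simp add: T_def frobenius_sum mult.commute flip: power_mult)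
  also have "\<dots> = (\<Sum>i<Suc m. x ^ (q ^ i)) - x"
    by (simp add: sum.lessThan_Suc_shift del: sum.lessThan_Suc)
  also have "\<dots> = T x"
    using power_card_field_eq[of x] by (simp add: T_def card_r)
  finally show ?thesis .
qed

text \<open>The polynomial \<open>P\<close> has at most \<open>q\<close> roots, and the embedded
  field provides \<open>q\<close> of them.\<close>

lemma range_iota: "range \<iota> = {z. z ^ q = z}"
proof (rule card_seteq)
  show "range \<iota> \<subseteq> {z. z ^ q = z}" using iota_power_q[of _ 1] by auto
  define P :: "'r poly" where "P = monom 1 q - monom 1 1"
  have "poly.coeff P q = 1" using q_gt1 by (simp add: P_def)
  then have "P \<noteq> 0" by auto
  have "degree P \<le> q" unfolding P_def
    using q_gt1 by (intro degree_diff_le) (auto intro: order.trans[OF degree_monom_le])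
  moreover have "{z. z ^ q = z} = {z. poly P z = 0}" by (simp add: P_def poly_monom)
  ultimately show "card {z::'r. z ^ q = z} \<le> card (range \<iota>)"
    using card_poly_roots_bound[OF \<open>P \<noteq> 0\<close>] by (simp add: card_image[OF iota_inj] card_q)
qed auto

lemma iota_trace: "\<iota> (field_trace \<iota> m x) = T x"
proof -
  have "T x \<in> range \<iota>" by (simp add: range_iota T_power_q)
  then obtain y where y: "T x = \<iota> y" by blast
  have "field_trace \<iota> m x = y"
    unfolding field_trace_def card_q T_def[symmetric] y
    by (rule the_equality) (auto dest: injD[OF iota_inj])
  then show ?thesis using y by simp
qed

lemma trace_eq_0_iff: "field_trace \<iota> m x = 0 \<longleftrightarrow> T x = 0"
  by (metis iota_eq_0_iff iota_trace)

lemma trace_add: "field_trace \<iota> m (x + y) = field_trace \<iota> m x + field_trace \<iota> m y"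
  by (rule injD[OF iota_inj]) (simp add: iota_trace iota_add T_add)

lemma trace_scale: "field_trace \<iota> m (\<iota> c * x) = c * field_trace \<iota> m x"
  by (rule injD[OF iota_inj]) (simp add: iota_trace iota_mult T_scale)

lemma sum_over_trace_fibres:
  fixes f :: "'r \<Rightarrow> 'b::comm_monoid_add"
  shows "(\<Sum>c\<in>UNIV. \<Sum>x | T x = \<iota> c. f x) = (\<Sum>x\<in>UNIV. f x)"
proof -
  have "(\<Sum>c\<in>UNIV. \<Sum>x\<in>{x \<in> UNIV. field_trace \<iota> m x = c}. f x) = (\<Sum>x\<in>UNIV. f x)"
    by (rule sum.group) auto
  moreover have "T x = \<iota> c \<longleftrightarrow> field_trace \<iota> m x = c" for x c
    by (metis injD[OF iota_inj] iota_trace)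
  ultimately show ?thesis by simp
qed

text \<open>The upper bound is the degree of the trace polynomial, the lower bound holds since no fibre of
  the trace is larger than its kernel.\<close>

lemma card_trace_kernel: "card {x. T x = 0} = q ^ (m - 1)"
proof (rule antisym)
  define P :: "'r poly" where "P = (\<Sum>i<m. monom 1 (q ^ i))"
  have roots: "{x. T x = 0} = {x. poly P x = 0}"
    by (simp add: P_def T_def poly_sum poly_monom)
  \<comment> \<open>Among the exponents \<open>q ^ i\<close> only \<open>i = 0\<close> gives 1, so
    the linear coefficient of \<open>P\<close> is 1 and \<open>P\<close> is nonzero.\<close>
  have "q ^ i = q ^ 0 \<longleftrightarrow> i = 0" for i
    using q_gt1 by (simp only: power_inject_exp)
  then have "poly.coeff P 1 = 1"
    using m_pos by (simp add: P_def coeff_sum)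
  then have "P \<noteq> 0" by auto
  moreover have "degree P \<le> q ^ (m - 1)"
    unfolding P_def
  proof (rule degree_sum_le)
    fix i assume "i \<in> {..<m}"
    then show "degree (monom (1::'r) (q ^ i)) \<le> q ^ (m - 1)"
      using q_gt1 by (intro order.trans[OF degree_monom_le] power_increasing) auto
  qed simp
  ultimately show "card {x. T x = 0} \<le> q ^ (m - 1)"
    unfolding roots using card_poly_roots_bound order.trans by blast
next
  have fibre: "card {x. T x = \<iota> c} \<le> card {x. T x = 0}" for c
  proof (cases "\<exists>y. T y = \<iota> c")
    case True
    then obtain y where "T y = \<iota> c" by blast
    then have "(\<lambda>x. x - y) ` {x. T x = \<iota> c} \<subseteq> {x. T x = 0}"
      using T_add[of _ "- y"] by (auto simp: T_minus)
    then show ?thesis by (rule card_inj_on_le[rotated]) (auto simp: inj_on_def)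
  qed simp
  have "q ^ m = (\<Sum>c\<in>UNIV. card {x. T x = \<iota> c})"
    using sum_over_trace_fibres[of "\<lambda>_. 1::nat"] by (simp add: card_r)
  also have "\<dots> \<le> q * card {x. T x = 0}"
    using sum_mono[of "UNIV :: 'q set", OF fibre] by (simp add: card_q)
  finally have "q * q ^ (m - 1) \<le> q * card {x. T x = 0}"
    using m_pos by (simp add: power_eq_if split: if_splits)
  then show "q ^ (m - 1) \<le> card {x. T x = 0}" using q_gt1 by simp
qed

lemma card_r_minus: "CARD('r) - 1 = (CARD('r) - 1) div (q - 1) * (q - 1)"
proof -
  have "int q - 1 dvd int q ^ m - 1" by (simp add: power_diff_1_eq)
  then have "int (q - 1) dvd int (q ^ m - 1)" using q_gt1 by (simp add: of_nat_diff)
  then have "q - 1 dvd CARD('r) - 1" by (simp only: card_r int_dvd_int_iff)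
  then show ?thesis by simp
qed

text \<open>As \<open>\<iota> c ^ (q - 1) = 1\<close>, the discrete logarithm of
  \<open>\<iota> c\<close> is a multiple of the even index.\<close>

lemma quad_char_iota:
  assumes "c \<noteq> 0" shows "quad_char (\<iota> c) = 1"
proof -
  obtain i where i: "\<iota> c = \<gamma> powi i" using assms by (metis gamma_powE iota_eq_0_iff)
  define k where "k = (CARD('r) - 1) div (q - 1)"
  have k: "CARD('r) - 1 = k * (q - 1)" unfolding k_def by (rule card_r_minus)
  have "\<iota> c ^ (q - 1) = 1"
    using power_card_field[OF assms] by (simp add: card_q flip: iota_power)
  then have "\<gamma> powi (i * int (q - 1)) = 1" by (simp only: i power_int_power')
  then have "int k * int (q - 1) dvd i * int (q - 1)"
    by (simp only: powi_eq_1_iff M_eq k of_nat_mult)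
  then have "int k dvd i" using q_gt1 by simp
  moreover have "even (int k)" using even_index by (simp add: k_def)
  ultimately have "even i" by (rule dvd_trans[rotated])
  then show ?thesis by (simp add: i quad_char_powi)
qed

section \<open>Character sums over the fibres of the trace\<close>

definition E :: "'q \<Rightarrow> real" where "E c = (\<Sum>x | T x = \<iota> c. quad_char x)"

text \<open>Division by \<open>\<iota> c\<close> carries the fibre over \<open>c\<close> to the
  fibre over 1 and, \<open>\<iota> c\<close> being a square, preserves the character.\<close>

lemma E_eq_E_1: "c \<noteq> 0 \<Longrightarrow> E c = E 1"
proof -
  assume c: "c \<noteq> 0"
  have inv: "\<iota> (inverse c) = inverse (\<iota> c)"
    using c iota_mult[of c "inverse c"] by (simp add: inverse_unique)
  have T_div: "T (x / \<iota> c) = T x / \<iota> c" for x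
    using T_scale[of "inverse c" x] by (simp add: inv divide_inverse mult.commute)
  have "E 1 = (\<Sum>x | T x = \<iota> c. quad_char (x / \<iota> c))"
    unfolding E_def
    by (rule sum.reindex_bij_witness[of _ "\<lambda>x. x / \<iota> c" "\<lambda>x. \<iota> c * x"])
       (use c in \<open>auto simp: T_scale T_div\<close>)
  also have "\<dots> = E c"
    unfolding E_def divide_inverse quad_char_mult quad_char_inverse quad_char_iota[OF c] by simp
  finally show ?thesis by simp
qed

lemma sum_UNIV_q:
  fixes f :: "'q \<Rightarrow> real"
  assumes "\<And>c. c \<noteq> 0 \<Longrightarrow> f c = f 1"
  shows "(\<Sum>c\<in>UNIV. f c) = f 0 + (real q - 1) * f 1"
proof -
  have "(\<Sum>c\<in>UNIV. f c) = f 0 + (\<Sum>c\<in>UNIV-{0}. f c)"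
    using sum.remove[of UNIV 0 f] by simp
  also have "(\<Sum>c\<in>UNIV-{0}. f c) = (\<Sum>c\<in>UNIV-{0::'q}. f 1)"
    by (intro sum.cong refl assms) auto
  also have "\<dots> = (real q - 1) * f 1"
    using q_gt1 by (simp add: card_Diff_singleton card_q of_nat_diff)
  finally show ?thesis .
qed

text \<open>The fibres partition the field, over which the character sums to 0.\<close>

lemma E_sum: "E 0 + (real q - 1) * E 1 = 0"
proof -
  have "(\<Sum>c\<in>UNIV. E c) = 0"
    unfolding E_def sum_over_trace_fibres by (rule sum_quad_char)
  then show ?thesis using sum_UNIV_q[of E, OF E_eq_E_1] by simp
qed

text \<open>Both sides count the pairs whose sum lies in the kernel of the trace, weighted by the product of
  their quadratic characters.\<close>

lemma E_square_sum:
  "(E 0)\<^sup>2 + (real q - 1) * (E 1)\<^sup>2 = real CARD('r) - real (q ^ (m - 1))"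
proof -
  have "(\<Sum>c\<in>UNIV. E c * E c) = (\<Sum>c\<in>UNIV. \<Sum>x | T x = \<iota> c. quad_char x * E c)"
    by (simp add: E_def sum_distrib_right)
  also have "\<dots> = (\<Sum>c\<in>UNIV. \<Sum>x | T x = \<iota> c. \<Sum>d | T d = 0. quad_char x * quad_char (d - x))"
  proof (intro sum.cong refl)
    fix c x assume "x \<in> {x. T x = \<iota> c}"
    then have x: "T x = \<iota> c" by simp
    \<comment> \<open>For \<open>x\<close> in the fibre over \<open>c\<close>, the map
      \<open>d \<mapsto> x - d\<close> carries the kernel onto that fibre.\<close>
    have "(\<Sum>d | T d = 0. quad_char (d - x)) = (\<Sum>y | T y = \<iota> c. quad_char (- y))"
      by (rule sum.reindex_bij_witness[of _ "\<lambda>y. x - y" "\<lambda>d. x - d"])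
         (use x T_add[of x "- _"] in \<open>auto simp: T_minus\<close>)
    then show "quad_char x * E c = (\<Sum>d | T d = 0. quad_char x * quad_char (d - x))"
      by (simp only: E_def quad_char_minus flip: sum_distrib_left)
  qed
  also have "\<dots> = (\<Sum>x\<in>UNIV. \<Sum>d | T d = 0. quad_char x * quad_char (d - x))"
    by (rule sum_over_trace_fibres)
  also have "\<dots> = (\<Sum>d | T d = 0. \<Sum>x\<in>UNIV. quad_char x * quad_char (d - x))"
    by (rule sum.swap)
  also have "\<dots> = (\<Sum>d | T d = 0. (if d = 0 then real CARD('r) else 0) - 1)"
    by (simp only: sum_quad_char_convolution)
  also have "\<dots> = real CARD('r) - real (q ^ (m - 1))"
    by (simp add: sum_subtractf card_trace_kernel)
  also have "(\<Sum>c\<in>UNIV. E c * E c) = E 0 * E 0 + (real q - 1) * (E 1 * E 1)"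
    by (rule sum_UNIV_q) (metis E_eq_E_1)
  finally show ?thesis by (simp add: power2_eq_square)
qed

lemma card_r_div: "real CARD('r) = real q * real (q ^ (m - 1))"
  using m_pos by (simp add: card_r power_eq_if)

text \<open>\<open>E_sum\<close> and \<open>E_square_sum\<close> are two equations in
  \<open>E 0\<close> and \<open>E 1\<close>; eliminating \<open>E 1\<close> determines the square of
  \<open>E 0\<close> and leaves its sign open. The minus before \<open>\<epsilon>\<close> lets it
  enter the weights with a plus.\<close>

lemma E_0: "\<exists>\<epsilon>. (\<epsilon> = 1 \<or> \<epsilon> = -1) \<and> E 0 = - \<epsilon> * ((real q - 1) / real q * sqrt (real CARD('r)))"
proof -
  let ?q = "real q" and ?V = "real (q ^ (m - 1))"
  have q: "?q > 1" using q_gt1 by simp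
  have E0: "E 0 = - ((?q - 1) * E 1)" using E_sum by simp
  have "(E 0)\<^sup>2 + (?q - 1) * (E 1)\<^sup>2 = ?q * ?V - ?V"
    using E_square_sum by (simp only: card_r_div)
  then have "(?q - 1) * (?q * (E 1)\<^sup>2) = (?q - 1) * ?V"
    unfolding E0 by (simp add: algebra_simps power2_eq_square)
  then have V: "?q * (E 1)\<^sup>2 = ?V" using q by (simp only: mult_cancel_left) simp
  have "(E 0)\<^sup>2 = (?q - 1)\<^sup>2 / ?q\<^sup>2 * (?q * ?V)"
    unfolding E0 V[symmetric] using q by (simp add: power2_eq_square)
  moreover have "(sqrt (real CARD('r)))\<^sup>2 = ?q * ?V"
    by (simp only: card_r_div[symmetric]) simp
  ultimately have "(E 0)\<^sup>2 = ((?q - 1) / ?q * sqrt (real CARD('r)))\<^sup>2"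
    by (simp only: power_mult_distrib power_divide)
  then have "E 0 = (?q - 1) / ?q * sqrt (real CARD('r)) \<or> E 0 = - ((?q - 1) / ?q * sqrt (real CARD('r)))"
    by (simp only: power2_eq_iff)
  then show ?thesis by (metis minus_minus mult_minus1 mult_1)
qed

text \<open>The sum runs over \<open>y\<close> rather than over the squares, so each nonzero square
  counts twice.\<close>

definition Phi :: "'r \<Rightarrow> real" where
  "Phi z = (\<Sum>y\<in>UNIV-{0}. if T (y ^ 2 * z) = 0 then 0 else 1)"

text \<open>By \<open>sum_squares_eq\<close> the sum runs over \<open>s\<close> with weight
  \<open>1 + quad_char s\<close>, whose total is \<open>CARD('r)\<close>; the part to be removed
  becomes, after the substitution \<open>x = s * z\<close>, a sum over the kernel of the
  trace.\<close>

lemma Phi_eq: "Phi z = (if z = 0 then 0 else real CARD('r) - real (q ^ (m - 1)) - quad_char z * E 0)"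
proof (cases "z = 0")
  case False
  let ?g = "\<lambda>s. if T (s * z) = 0 then 0 else 1 :: real"
  have shift: "(\<Sum>s | T (s * z) = 0. f s) = (\<Sum>x | T x = 0. f (x / z))" for f :: "'r \<Rightarrow> real"
    by (rule sum.reindex_bij_witness[of _ "\<lambda>x. x / z" "\<lambda>s. s * z"]) (use False in auto)
  have "Phi z = (\<Sum>s\<in>UNIV-{0}. (1 + quad_char s) * ?g s)"
    unfolding Phi_def by (rule sum_squares_eq)
  \<comment> \<open>The term \<open>s = 0\<close> may be added, since \<open>T 0 = 0\<close> makes
    it vanish.\<close>
  also have "\<dots> = (\<Sum>s\<in>UNIV. (1 + quad_char s) * ?g s)"
    by (rule sum.mono_neutral_left) auto
  also have "\<dots> = (\<Sum>s\<in>(UNIV::'r set). 1 + quad_char s) - (\<Sum>s | T (s * z) = 0. 1 + quad_char s)"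
    by (simp add: sum.If_cases Collect_neg_eq sum_diff if_distrib[of "\<lambda>x. _ * x"]
        Compl_eq_Diff_UNIV cong: if_cong)
  also have "(\<Sum>s\<in>(UNIV::'r set). 1 + quad_char s) = real CARD('r)"
    by (simp add: sum.distrib sum_quad_char)
  also have "(\<Sum>s | T (s * z) = 0. 1 + quad_char s) = real (q ^ (m - 1)) + quad_char z * E 0"
    unfolding shift divide_inverse quad_char_mult quad_char_inverse
    by (simp add: sum.distrib card_trace_kernel E_def sum_distrib_left mult.commute)
  finally show ?thesis using False by simp
qed (simp add: Phi_def)

end

section \<open>Weights of the codewords\<close>

text \<open>\<open>L\<close> is the exponent of \<beta>, so \<open>even_L\<close> makes \<beta> a
  square; \<open>gcd_2\<close> expresses N = 2, and \<open>e_eq\<close> with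
  \<open>distinct_mod\<close> says that all frequencies modulo \<open>e\<close> but one
  occur.\<close>

locale almost_full_trace_code = field_extension \<gamma> M \<iota> p s m q
  for \<gamma> :: "'r::{field,finite}" and M :: int and \<iota> :: "'q::{field,finite} \<Rightarrow> 'r" and p s m q :: nat +
  fixes e t \<delta> n L :: nat and a :: int and \<Delta> as :: "nat \<Rightarrow> int"
  assumes e_eq: "e = t + 1"
    and L_eq: "CARD('r) - 1 = L * e"
    and distinct_mod: "\<forall>i\<in>{1..t}. \<forall>j\<in>{1..t}. i \<noteq> j \<longrightarrow> \<not> [\<Delta> i = \<Delta> j] (mod int e)"
    and as_cong: "\<forall>i\<in>{1..t}. [as i = a + int L * \<Delta> i] (mod M)"
    and delta_eq: "int \<delta> = Gcd (insert M (as ` {1..t}))"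
    and n_eq: "n = (CARD('r) - 1) div \<delta>"
    and gcd_2: "gcd (int ((CARD('r) - 1) div (q - 1))) (a * int e) = 2"
    and even_L: "even L" and even_a: "even a"
begin

lemma M_L: "M = int L * int e"
  using L_eq by (simp add: M_eq flip: of_nat_mult)

lemma e_pos: "e > 0" and L_pos: "L > 0"
  using L_eq card_gt1 e_eq by (auto intro: gr0I)

lemma delta_n: "M = int n * int \<delta>" and n_pos: "n > 0" and delta_pos: "\<delta> > 0"
proof -
  have "int \<delta> dvd M" unfolding delta_eq by (rule Gcd_dvd) simp
  then have "\<delta> dvd CARD('r) - 1" by (simp add: M_eq int_dvd_int_iff del: of_nat_diff)
  then have *: "CARD('r) - 1 = n * \<delta>" by (simp add: n_eq)
  then show "M = int n * int \<delta>" by (simp add: M_eq flip: of_nat_mult)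
  show "n > 0" "\<delta> > 0" using * card_gt1 by (auto intro: gr0I)
qed

lemma powi_cong: "M dvd i - j \<Longrightarrow> \<gamma> powi i = \<gamma> powi j"
  by (simp add: powi_eq_iff)

text \<open>The argument of the trace at position \<open>i\<close>, defined for all integers so that
  periodicity can be exploited.\<close>

definition f :: "(nat \<Rightarrow> 'r) \<Rightarrow> int \<Rightarrow> 'r" where
  "f x i = (\<Sum>j=1..t. x j * \<gamma> powi (as j * i))"

text \<open>A discrete Fourier transform of length \<open>e\<close>, based on the root of unity
  \<open>\<gamma> powi int L\<close> of order \<open>e\<close>.\<close>

definition y :: "(nat \<Rightarrow> 'r) \<Rightarrow> int \<Rightarrow> 'r" where
  "y x i = (\<Sum>j=1..t. x j * \<gamma> powi (int L * \<Delta> j * i))"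

lemma f_eq: "f x i = \<gamma> powi (a * i) * y x i"
proof -
  have "\<gamma> powi (as j * i) = \<gamma> powi (a * i) * \<gamma> powi (int L * \<Delta> j * i)" if "j \<in> {1..t}" for j
  proof -
    have "M dvd as j - (a + int L * \<Delta> j)" using as_cong that by (simp add: cong_iff_dvd_diff)
    then have "M dvd (as j - (a + int L * \<Delta> j)) * i" by simp
    then have "M dvd as j * i - (a * i + int L * \<Delta> j * i)" by (simp add: algebra_simps)
    then show ?thesis by (simp add: powi_cong power_int_add)
  qed
  then have "f x i = (\<Sum>j=1..t. x j * (\<gamma> powi (a * i) * \<gamma> powi (int L * \<Delta> j * i)))"
    unfolding f_def by (intro sum.cong refl) simp
  then show ?thesis by (simp add: y_def sum_distrib_left mult_ac)
qed

text \<open>Every \<open>as j\<close> is divisible by \<open>\<delta>\<close>, and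
  \<open>n * \<delta>\<close> is the order of \<open>\<gamma>\<close>.\<close>

lemma f_mod_n: "f x (i mod int n) = f x i"
  unfolding f_def
proof (intro sum.cong refl arg_cong2[where f = "(*)"] powi_cong)
  fix j assume "j \<in> {1..t}"
  then have "int \<delta> dvd as j" unfolding delta_eq by (intro Gcd_dvd) auto
  moreover have "int n dvd i mod int n - i" by (simp add: mod_eq_dvd_iff[symmetric])
  ultimately have "int n * int \<delta> dvd (i mod int n - i) * as j" by (intro mult_dvd_mono)
  then show "M dvd as j * (i mod int n) - as j * i" by (simp add: delta_n algebra_simps)
qed

lemma y_mod_e: "y x (i mod int e) = y x i"
  unfolding y_def
proof (intro sum.cong refl arg_cong2[where f = "(*)"] powi_cong)
  fix j
  have "int e dvd i mod int e - i" by (simp add: mod_eq_dvd_iff[symmetric])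
  then have "int e dvd \<Delta> j * (i mod int e - i)" by simp
  then have "int L * int e dvd int L * (\<Delta> j * (i mod int e - i))" by simp
  then show "M dvd int L * \<Delta> j * (i mod int e) - int L * \<Delta> j * i"
    by (simp add: M_L algebra_simps)
qed

lemma f_shift: "f x (i + int e * l) = \<gamma> powi (a * int e * l) * f x i"
proof -
  have "y x (i + int e * l) = y x i" by (metis mod_mult_self2 y_mod_e)
  then show ?thesis by (simp add: f_eq power_int_add distrib_left mult_ac)
qed

definition \<phi> :: "'r \<Rightarrow> real" where "\<phi> z = (if T z = 0 then 0 else 1)"

lemma codeword_nth:
  "i < n \<Longrightarrow> codeword \<iota> m \<gamma> n t as x i = field_trace \<iota> m (f x (int i))"
  by (simp add: codeword_def f_def)

text \<open>A full period \<open>M\<close> of exponents consists of \<open>\<delta>\<close> copies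
  of the \<open>n\<close> positions.\<close>

lemma delta_weight:
  "real \<delta> * real (hamming_weight n (codeword \<iota> m \<gamma> n t as x)) = (\<Sum>i\<in>{0..<M}. \<phi> (f x i))"
proof -
  have "{i. i < n \<and> codeword \<iota> m \<gamma> n t as x i \<noteq> 0} = {i \<in> {..<n}. T (f x (int i)) \<noteq> 0}"
    by (auto simp: codeword_nth trace_eq_0_iff)
  then have "real (hamming_weight n (codeword \<iota> m \<gamma> n t as x)) = (\<Sum>i<n. \<phi> (f x (int i)))"
    by (simp add: hamming_weight_def \<phi>_def sum.If_cases Int_def flip: Collect_neg_eq)
  also have "\<dots> = (\<Sum>i\<in>{0..<int n}. \<phi> (f x i))"
    by (rule sum.reindex_bij_witness[of _ nat int]) auto
  also have "real \<delta> * \<dots> = (\<Sum>i\<in>{0..<M}. \<phi> (f x i))"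
    unfolding delta_n using n_pos by (intro sum_periodic_multiple[symmetric]) (auto simp: f_mod_n)
  finally show ?thesis .
qed

text \<open>Such a power of \<open>\<gamma>\<close> is fixed by the \<open>q\<close>-th power map,
  so it lies in the small field, over which \<open>T\<close> is linear.\<close>

lemma phi_scale:
  assumes "int ((CARD('r) - 1) div (q - 1)) dvd i"
  shows "\<phi> (\<gamma> powi i * z) = \<phi> z"
proof -
  have "int ((CARD('r) - 1) div (q - 1)) * int (q - 1) dvd i * int (q - 1)"
    using assms by (intro mult_dvd_mono) simp_all
  then have "M dvd i * int (q - 1)"
    using card_r_minus by (simp only: M_eq of_nat_mult[symmetric])
  then have "\<gamma> powi (i * int (q - 1)) = 1" by (simp only: powi_eq_1_iff)
  then have "(\<gamma> powi i) ^ (q - 1) = 1" by (simp only: power_int_power')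
  moreover have "(\<gamma> powi i) ^ q = \<gamma> powi i * (\<gamma> powi i) ^ (q - 1)"
    using q_gt1 by (simp flip: power_Suc)
  ultimately have "\<gamma> powi i \<in> range \<iota>" by (simp add: range_iota)
  then obtain c where "\<gamma> powi i = \<iota> c" by blast
  moreover from this have "c \<noteq> 0" by (metis gamma_nz iota_0 power_int_not_zero)
  ultimately show ?thesis by (simp add: \<phi>_def T_scale)
qed

lemma sum_gamma: "(\<Sum>i\<in>{0..<M}. g (\<gamma> powi i)) = (\<Sum>z\<in>UNIV-{0}. g z)"
  by (rule sum.reindex_bij_betw[OF gamma_bij])

text \<open>The kernel of the trace is stable under the nonzero elements of the small field, so only the
  residue of the exponent modulo \<open>(CARD('r) - 1) div (q - 1)\<close> matters, and there the multiples of
  \<open>a * e\<close> are exactly the even residues.\<close>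

lemma sum_phi_orbit: "(\<Sum>l\<in>{0..<M}. \<phi> (\<gamma> powi (a * int e * l) * z)) = Phi z"
proof -
  let ?k = "int ((CARD('r) - 1) div (q - 1))"
  have "2 dvd ?k" "2 dvd a * int e" using gcd_2 by (metis gcd_dvd1, metis gcd_dvd2)
  then obtain k' b where k': "?k = 2 * k'" and b: "a * int e = 2 * b" by (meson dvdE)
  \<comment> \<open>Dividing N = 2 by the common factor 2 makes \<open>b\<close> a unit modulo
    \<open>k'\<close>.\<close>
  have "2 * gcd b k' = 2"
    using gcd_2 gcd_mult_distrib_int[of 2 k' b] unfolding k' b by (simp add: gcd.commute)
  then have cop: "coprime b k'" by (simp add: coprime_iff_gcd_eq_1)
  have M: "M = k' * int (2 * (q - 1))"
    using card_r_minus k' unfolding M_eq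
    by (metis (no_types, opaque_lifting) mult.assoc mult.commute of_nat_mult of_nat_numeral)
  have k'_pos: "k' > 0" using M M_pos q_gt1 by (simp add: zero_less_mult_iff)
  define G where "G l = \<phi> (\<gamma> powi (2 * l) * z)" for l
  have G_per: "G i = G j" if "k' dvd i - j" for i j
  proof -
    have "2 * k' dvd 2 * (i - j)" using that by (rule mult_dvd_mono[OF dvd_refl])
    then have "?k dvd 2 * i - 2 * j" by (simp only: k' right_diff_distrib)
    then have "\<phi> (\<gamma> powi (2 * i - 2 * j) * (\<gamma> powi (2 * j) * z)) = G j"
      unfolding G_def by (rule phi_scale)
    moreover have "\<gamma> powi (2 * i) = \<gamma> powi (2 * i - 2 * j) * \<gamma> powi (2 * j)"
      by (subst power_int_add[symmetric]) simp_all
    ultimately show ?thesis by (simp add: G_def mult.assoc)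
  qed
  have G_mod: "G (i mod k') = G i" and Gb_mod: "G (b * (i mod k')) = G (b * i)" for i
    by (rule G_per, simp add: mod_eq_dvd_iff[symmetric] mod_mult_right_eq)+
  have "(\<Sum>l\<in>{0..<M}. \<phi> (\<gamma> powi (a * int e * l) * z)) = (\<Sum>l\<in>{0..<M}. G (b * l))"
    by (simp add: G_def b mult.assoc)
  \<comment> \<open>\<open>M\<close> holds \<open>2 * (q - 1)\<close> periods of length
    \<open>k'\<close>; on one period multiplication by \<open>b\<close> only permutes the residues,
    and afterwards the full range is restored.\<close>
  also have "\<dots> = real (2 * (q - 1)) * (\<Sum>l\<in>{0..<k'}. G (b * l))"
    unfolding M by (rule sum_periodic_multiple[OF k'_pos, of "\<lambda>l. G (b * l)"]) (rule Gb_mod)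
  also have "(\<Sum>l\<in>{0..<k'}. G (b * l)) = (\<Sum>l\<in>{0..<k'}. G l)"
    by (rule sum_periodic_scale[OF k'_pos _ cop, of G]) (rule G_mod)
  also have "real (2 * (q - 1)) * (\<Sum>l\<in>{0..<k'}. G l) = (\<Sum>l\<in>{0..<M}. G l)"
    unfolding M by (rule sum_periodic_multiple[OF k'_pos, of G, symmetric]) (rule G_mod)
  also have "\<dots> = (\<Sum>l\<in>{0..<M}. \<phi> ((\<gamma> powi l) ^ 2 * z))"
    by (simp add: G_def power_int_power' mult.commute)
  also have "\<dots> = Phi z"
    using sum_gamma[of "\<lambda>u. \<phi> (u ^ 2 * z)"] by (simp add: Phi_def \<phi>_def)
  finally show ?thesis .
qed

lemma Phi_scale: "even i \<Longrightarrow> Phi (\<gamma> powi i * z) = Phi z"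
  by (simp add: Phi_eq quad_char_mult quad_char_powi)

text \<open>Averaging over all shifts by multiples of \<open>e\<close> turns each term into an orbit
  sum, hence into \<open>Phi (f x i)\<close>. The factor \<open>\<gamma> powi (a * i)\<close> is a
  square as \<open>a\<close> is even, so \<open>f\<close> may be replaced by \<open>y\<close>, which
  has period \<open>e\<close>.\<close>

lemma sum_phi: "real e * (\<Sum>i\<in>{0..<M}. \<phi> (f x i)) = (\<Sum>h\<in>{0..<int e}. Phi (y x h))"
proof -
  let ?S = "\<Sum>i\<in>{0..<M}. \<phi> (f x i)"
  have f_mod_M: "f x (i mod M) = f x i" for i
    by (metis delta_n dvd_triv_left f_mod_n mod_mod_cancel)
  have "real L * (real e * ?S) = (\<Sum>l\<in>{0..<M}. ?S)"
    using M_L M_pos by (simp flip: of_nat_mult)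
  also have "\<dots> = (\<Sum>l\<in>{0..<M}. \<Sum>i\<in>{0..<M}. \<phi> (f x (i + int e * l)))"
    by (intro sum.cong refl sum_periodic_shift[symmetric, of M "\<lambda>i. \<phi> (f x i)"])
       (simp_all add: M_pos f_mod_M)
  also have "\<dots> = (\<Sum>i\<in>{0..<M}. \<Sum>l\<in>{0..<M}. \<phi> (\<gamma> powi (a * int e * l) * f x i))"
    unfolding f_shift by (rule sum.swap)
  also have "\<dots> = (\<Sum>i\<in>{0..<M}. Phi (y x i))"
    unfolding sum_phi_orbit unfolding f_eq using even_a by (simp add: Phi_scale)
  also have "\<dots> = (\<Sum>i\<in>{0..<int e * int L}. Phi (y x i))" by (simp add: M_L mult.commute)
  also have "\<dots> = real L * (\<Sum>h\<in>{0..<int e}. Phi (y x h))"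
    by (rule sum_periodic_multiple) (simp_all add: y_mod_e e_pos)
  finally show ?thesis using L_pos by simp
qed

text \<open>The values of \<open>Phi\<close> come from \<open>Phi_eq\<close> with \<open>E 0\<close>
  taken from \<open>E_0\<close>. The sign \<open>\<epsilon>\<close> is chosen before
  \<open>x\<close> since it depends only on the field extension.\<close>

lemma weight_formula:
  "\<exists>\<epsilon>. (\<epsilon> = 1 \<or> \<epsilon> = -1) \<and> (\<forall>x. real (hamming_weight n (codeword \<iota> m \<gamma> n t as x)) =
     (real q - 1) / (real e * real q * real \<delta>) *
     (\<Sum>h\<in>{0..<int e}. (if y x h = 0 then 0 else real CARD('r))
         + \<epsilon> * quad_char (y x h) * sqrt (real CARD('r))))"
proof -
  let ?R = "real CARD('r)"
  obtain \<epsilon> where \<epsilon>: "\<epsilon> = 1 \<or> \<epsilon> = -1" "E 0 = - \<epsilon> * ((real q - 1) / real q * sqrt ?R)"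
    using E_0 by blast
  have V: "real (q ^ (m - 1)) = ?R / real q" using card_r_div q_gt1 by simp
  have Phi: "Phi z = (real q - 1) / real q *
      ((if z = 0 then 0 else ?R) + \<epsilon> * quad_char z * sqrt ?R)" for z
    using q_gt1 unfolding Phi_eq V \<epsilon>(2) by (simp add: field_simps)
  have "real (hamming_weight n (codeword \<iota> m \<gamma> n t as x)) =
     (real q - 1) / (real e * real q * real \<delta>) *
     (\<Sum>h\<in>{0..<int e}. (if y x h = 0 then 0 else ?R) + \<epsilon> * quad_char (y x h) * sqrt ?R)" for x
  proof -
    let ?S = "\<Sum>h\<in>{0..<int e}. (if y x h = 0 then 0 else ?R) + \<epsilon> * quad_char (y x h) * sqrt ?R"
    have "real e * (real \<delta> * real (hamming_weight n (codeword \<iota> m \<gamma> n t as x)))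
      = (real q - 1) / real q * ?S"
      unfolding delta_weight sum_phi Phi by (simp only: sum_distrib_left)
    moreover have "w = c / d * S / (u * v)" if "u * (v * w) = c / d * S" "u \<noteq> 0" "v \<noteq> 0"
      for u v w c d S :: real
      using that by (metis mult.assoc mult_eq_0_iff nonzero_mult_div_cancel_left)
    ultimately have "real (hamming_weight n (codeword \<iota> m \<gamma> n t as x))
      = (real q - 1) / real q * ?S / (real e * real \<delta>)"
      using e_pos delta_pos by simp
    then show ?thesis by (simp add: mult_ac)
  qed
  then show ?thesis using \<epsilon>(1) by blast
qed

end

section \<open>Zero-sum vectors of given type\<close>

text \<open>The number of zero-sum vectors with \<open>N\<close> prescribed nonzero positions and
  prescribed classes there, \<open>u\<close> of them in one class: the case \<open>c = 0\<close> of
  \<open>card_sums_of_quad_classes\<close>, where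
  \<open>psi \<theta> 0 = (R - 1) / 2\<close>.\<close>

definition class_count :: "real \<Rightarrow> nat \<Rightarrow> nat \<Rightarrow> real" where
  "class_count R N u = (((R - 1) / 2) ^ N + (R - 1) / 2 *
     (quad_period R 1 ^ u * quad_period R (- 1) ^ (N - u) + quad_period R (- 1) ^ u * quad_period R 1 ^ (N - u))) / R"

context field_generator
begin

text \<open>Zero entries do not affect the sum, so restriction to the support \<open>J\<close> is a
  bijection onto the vectors with classes prescribed by \<open>A\<close>; its inverse extends by 0.
  Changing the sign of \<open>\<epsilon>\<close> only swaps the two products in
  \<open>class_count\<close>.\<close>

lemma card_zero_sums_of_quad_classes:
  assumes "finite I" "J \<subseteq> I" "A \<subseteq> J" and \<epsilon>: "\<epsilon> = 1 \<or> \<epsilon> = -1"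
  shows "real (card {z \<in> PiE I (\<lambda>_. UNIV :: 'r set). sum z I = 0 \<and>
      {h \<in> I. z h \<noteq> 0} = J \<and> {h \<in> I. \<epsilon> * quad_char (z h) = 1} = A})
    = class_count (real CARD('r)) (card J) (card A)"
proof -
  let ?R = "real CARD('r)"
  define \<tau> where "\<tau> h = (if h \<in> A then \<epsilon> else - \<epsilon>)" for h
  have fin: "finite J" "finite A" using assms(1-3) by (meson finite_subset)+
  have \<tau>: "\<tau> h = 1 \<or> \<tau> h = -1" for h using \<epsilon> by (auto simp: \<tau>_def)
  let ?Z = "{z \<in> PiE I (\<lambda>_. UNIV :: 'r set). sum z I = 0 \<and>
      {h \<in> I. z h \<noteq> 0} = J \<and> {h \<in> I. \<epsilon> * quad_char (z h) = 1} = A}"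
  let ?W = "{z \<in> PiE J (\<lambda>h. {s::'r. quad_char s = \<tau> h}). sum z J = 0}"
  have "bij_betw (\<lambda>z. restrict z J) ?Z ?W"
  proof (rule bij_betw_byWitness[where f' = "\<lambda>w. restrict (\<lambda>h. if h \<in> J then w h else 0) I"])
    show "\<forall>z\<in>?Z. restrict (\<lambda>h. if h \<in> J then restrict z J h else 0) I = z"
    proof
      fix z assume z: "z \<in> ?Z"
      have ext: "z h = undefined" if "h \<notin> I" for h using z that by (blast intro: PiE_arb)
      have "z h = 0" if "h \<in> I" "h \<notin> J" for h using z that by blast
      note zero = this
      show "restrict (\<lambda>h. if h \<in> J then restrict z J h else 0) I = z"
      proof
        fix h show "restrict (\<lambda>h. if h \<in> J then restrict z J h else 0) I h = z h"
          by (simp add: ext zero)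
      qed
    qed
    show "\<forall>w\<in>?W. restrict (restrict (\<lambda>h. if h \<in> J then w h else 0) I) J = w"
    proof
      fix w assume w: "w \<in> ?W"
      have ext: "w h = undefined" if "h \<notin> J" for h using w that by (blast intro: PiE_arb)
      show "restrict (restrict (\<lambda>h. if h \<in> J then w h else 0) I) J = w"
      proof
        fix h show "restrict (restrict (\<lambda>h. if h \<in> J then w h else 0) I) J h = w h"
          using assms(2) by (cases "h \<in> J") (auto simp: ext)
      qed
    qed
    show "(\<lambda>z. restrict z J) ` ?Z \<subseteq> ?W"
    proof (rule image_subsetI)
      fix z assume z: "z \<in> ?Z"
      then have J: "h \<in> J \<longleftrightarrow> h \<in> I \<and> z h \<noteq> 0" and A: "h \<in> A \<longleftrightarrow> h \<in> I \<and> \<epsilon> * quad_char (z h) = 1" for h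
        by blast+
      have "quad_char (z h) = \<tau> h" if "h \<in> J" for h
      proof -
        have "z h \<noteq> 0" "h \<in> I" using that J by auto
        then show ?thesis using quad_char_cases[of "z h"] A[of h] \<epsilon> by (auto simp: \<tau>_def)
      qed
      moreover have "sum z J = sum z I"
        using assms(1,2) J by (intro sum.mono_neutral_left) auto
      ultimately show "restrict z J \<in> ?W" using z by simp
    qed
    show "(\<lambda>w. restrict (\<lambda>h. if h \<in> J then w h else 0) I) ` ?W \<subseteq> ?Z"
    proof (rule image_subsetI)
      fix w assume w: "w \<in> ?W"
      let ?z = "restrict (\<lambda>h. if h \<in> J then w h else 0) I"
      have wq: "quad_char (w h) = \<tau> h" if "h \<in> J" for h using w that by auto
      have "w h \<noteq> 0" if "h \<in> J" for h using wq[OF that] \<tau>[of h] by auto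
      then have 1: "{h \<in> I. ?z h \<noteq> 0} = J" using assms(2) by auto
      have "\<epsilon> * \<epsilon> = 1" "\<epsilon> * (- \<epsilon>) \<noteq> 1" using \<epsilon> by auto
      then have 2: "{h \<in> I. \<epsilon> * quad_char (?z h) = 1} = A"
        using assms(2,3) wq by (auto simp: \<tau>_def split: if_splits)
      have "sum ?z I = sum ?z J"
        using assms(1,2) by (intro sum.mono_neutral_right) auto
      also have "\<dots> = sum w J" using assms(2) by (intro sum.cong) auto
      finally show "?z \<in> ?Z" using 1 2 w by simp
    qed
  qed
  then have "real (card ?Z) = real (card ?W)" by (simp only: bij_betw_same_card)
  also have "\<dots> = (((?R - 1) / 2) ^ card J + (\<Prod>h\<in>J. quad_period ?R (\<tau> h)) * ((?R - 1) / 2)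
      + (\<Prod>h\<in>J. quad_period ?R (- \<tau> h)) * ((?R - 1) / 2)) / ?R"
    by (subst card_sums_of_quad_classes[OF fin(1) \<tau>]) (simp add: psi_def field_simps)
  finally have Z: "real (card ?Z) = \<dots>" .
  \<comment> \<open>\<open>c = 1\<close> and \<open>c = -1\<close> give the products belonging to
    \<open>psi 1\<close> and \<open>psi (-1)\<close>.\<close>
  have prods: "(\<Prod>h\<in>J. quad_period ?R (c * \<tau> h))
      = quad_period ?R (c * \<epsilon>) ^ card A * quad_period ?R (- (c * \<epsilon>)) ^ (card J - card A)" for c
  proof -
    have "(\<Prod>h\<in>J. quad_period ?R (c * \<tau> h)) = (\<Prod>h\<in>A. quad_period ?R (c * \<tau> h)) * (\<Prod>h\<in>J - A. quad_period ?R (c * \<tau> h))"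
      using fin assms(3) prod.subset_diff[of A J "\<lambda>h. quad_period ?R (c * \<tau> h)"] by (simp add: mult.commute)
    also have "\<dots> = (\<Prod>h\<in>A. quad_period ?R (c * \<epsilon>)) * (\<Prod>h\<in>J - A. quad_period ?R (- (c * \<epsilon>)))"
      by (intro arg_cong2[where f = "(*)"] prod.cong) (auto simp: \<tau>_def)
    finally show ?thesis using fin assms(3) by (simp add: card_Diff_subset)
  qed
  show ?thesis
    using \<epsilon> prods[of 1] prods[of "-1"] unfolding Z class_count_def by (auto simp: algebra_simps)
qed

text \<open>The vectors are sorted by their support \<open>J\<close> and the part \<open>A\<close>
  of it in the chosen class; all choices of \<open>(J, A)\<close> contribute equally.\<close>

lemma card_zero_sums_of_type:
  assumes "finite I" and \<epsilon>: "\<epsilon> = 1 \<or> \<epsilon> = -1"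
  shows "real (card {z \<in> PiE I (\<lambda>_. UNIV :: 'r set). sum z I = 0 \<and>
      card {h \<in> I. z h \<noteq> 0} = N \<and> card {h \<in> I. \<epsilon> * quad_char (z h) = 1} = u})
    = real (card I choose N) * real (N choose u) * class_count (real CARD('r)) N u"
proof -
  let ?J = "\<lambda>z. {h \<in> I. z h \<noteq> (0::'r)}" and ?A = "\<lambda>z::_ \<Rightarrow> 'r. {h \<in> I. \<epsilon> * quad_char (z h) = 1}"
  let ?S = "{z \<in> PiE I (\<lambda>_. UNIV :: 'r set). sum z I = 0 \<and> card (?J z) = N \<and> card (?A z) = u}"
  let ?P = "SIGMA J:{J. J \<subseteq> I \<and> card J = N}. {A. A \<subseteq> J \<and> card A = u}"
  have finS: "finite ?S" using assms(1) by (simp add: finite_PiE)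
  have fin: "finite {A. A \<subseteq> J \<and> card A = j}" if "J \<subseteq> I" for J j
    by (rule finite_subset[of _ "Pow J"]) (use assms(1) that finite_subset in auto)
  have finP: "finite ?P" using fin by (intro finite_SigmaI) auto
  have "real (card ?S) = (\<Sum>z\<in>?S. 1)" by simp
  also have "\<dots> = (\<Sum>P\<in>?P. \<Sum>z\<in>{z \<in> ?S. (?J z, ?A z) = P}. 1)"
    by (rule sum.group[symmetric]) (use finS finP in auto)
  also have "\<dots> = (\<Sum>P\<in>?P. class_count (real CARD('r)) N u)"
  proof (intro sum.cong refl)
    fix P assume "P \<in> ?P"
    then obtain J A where P: "P = (J, A)" "J \<subseteq> I" "A \<subseteq> J" "card J = N" "card A = u" by auto
    have "{z \<in> ?S. (?J z, ?A z) = P} = {z \<in> PiE I (\<lambda>_. UNIV). sum z I = 0 \<and> ?J z = J \<and> ?A z = A}"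
      using P by blast
    then show "(\<Sum>z\<in>{z \<in> ?S. (?J z, ?A z) = P}. 1) = class_count (real CARD('r)) N u"
      using card_zero_sums_of_quad_classes[OF assms(1) P(2,3) \<epsilon>] P by simp
  qed
  also have "\<dots> = real (card ?P) * class_count (real CARD('r)) N u" by simp
  also have "card ?P = (\<Sum>J | J \<subseteq> I \<and> card J = N. card {A. A \<subseteq> J \<and> card A = u})"
    using fin by (intro card_SigmaI) auto
  also have "\<dots> = (\<Sum>J | J \<subseteq> I \<and> card J = N. N choose u)"
    using assms(1) by (intro sum.cong refl) (auto simp: n_subsets finite_subset)
  also have "\<dots> = (card I choose N) * (N choose u)"
    using assms(1) by (simp add: n_subsets)
  finally show ?thesis by simp
qed

end

text \<open>\<open>k + 1\<close> is the number of nonzero coordinates; pulling -1/2 out of each of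
  the \<open>k + 1\<close> periods produces the powers of -1 and 2 in \<open>freq\<close>.\<close>

lemma freq_eq_class_count:
  assumes "u \<le> k + 1" "r > 0"
  shows "freq r t k u = real ((t + 1) choose (k + 1)) * real ((k + 1) choose u) * class_count (real r) (k + 1) u"
proof -
  let ?s = "sqrt (real r)"
  obtain v where v: "k + 1 = u + v" using assms(1) le_Suc_ex by blast
  have p: "quad_period (real r) \<theta> ^ u * quad_period (real r) (- \<theta>) ^ (k + 1 - u) =
      (- 1) ^ (k + 1) * ((1 - \<theta> * ?s) ^ u * (1 + \<theta> * ?s) ^ (k + 1 - u)) / 2 ^ (k + 1)"
    if "\<theta> = 1 \<or> \<theta> = - 1" for \<theta>
  proof -
    have l: "quad_period (real r) \<theta> = (- 1) * ((1 - \<theta> * ?s) / 2)" "quad_period (real r) (- \<theta>) = (- 1) * ((1 + \<theta> * ?s) / 2)"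
      by (simp_all add: quad_period_def field_simps)
    show ?thesis
      unfolding l power_mult_distrib power_divide v add_diff_cancel_left' power_add by simp
  qed
  have "class_count (real r) (k + 1) u = (((real r - 1) / 2) ^ (k + 1) + (real r - 1) / 2 *
      ((- 1) ^ (k + 1) * ((1 - ?s) ^ u * (1 + ?s) ^ (k + 1 - u)) / 2 ^ (k + 1)
     + (- 1) ^ (k + 1) * ((1 + ?s) ^ u * (1 - ?s) ^ (k + 1 - u)) / 2 ^ (k + 1))) / real r"
    unfolding class_count_def using p[of 1] p[of "-1"] by (simp only: minus_minus) simp
  also have "\<dots> = (real r - 1) / (real r * 2 ^ (k + 2)) * (2 * (real r - 1) ^ k
      - (-1) ^ k * ((1 + ?s) ^ u * (1 - ?s) ^ (k + 1 - u) + (1 - ?s) ^ u * (1 + ?s) ^ (k + 1 - u)))"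
    using assms(2) by (simp add: power_divide field_simps)
  finally show ?thesis unfolding freq_def by (simp only: mult_ac)
qed

text \<open>A single nonzero entry cannot have sum 0; this is why the sum over frequencies starts at
  \<open>k = 1\<close>.\<close>

lemma class_count_1: "u \<le> 1 \<Longrightarrow> R \<ge> 0 \<Longrightarrow> class_count R 1 u = 0"
  by (cases u) (auto simp: class_count_def quad_period_def field_simps)

context field_generator
begin

text \<open>With \<open>N\<close> nonzero entries, \<open>u\<close> of them satisfying
  \<open>\<epsilon> * quad_char (z h) = 1\<close>, the signed character sum is
  \<open>u - (N - u)\<close>. So the weight depends on \<open>(N, u)\<close> only, and the vectors
  can be sorted by these pairs; finally \<open>N = k + 1\<close>.\<close>

lemma weight_distribution_zero_sums:
  assumes fin: "finite I" and card_I: "card I = t + 1" and \<epsilon>: "\<epsilon> = 1 \<or> \<epsilon> = -1" and "w > 0"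
  shows "real (card {z \<in> PiE I (\<lambda>_. UNIV :: 'r set). sum z I = 0 \<and>
      c * (\<Sum>h\<in>I. (if z h = 0 then 0 else real CARD('r)) + \<epsilon> * quad_char (z h) * sqrt (real CARD('r))) = w})
    = (\<Sum>(k, u) | 1 \<le> k \<and> k \<le> t \<and> u \<le> k + 1 \<and>
        c * ((real k + 1) * real CARD('r) - (real k + 1 - 2 * real u) * sqrt (real CARD('r))) = w.
        freq (CARD('r)) t k u)"
proof -
  let ?R = "real CARD('r)"
  let ?J = "\<lambda>z. {h \<in> I. z h \<noteq> (0::'r)}" and ?A = "\<lambda>z::_ \<Rightarrow> 'r. {h \<in> I. \<epsilon> * quad_char (z h) = 1}"
  define W where "W N u = c * (real N * ?R - (real N - 2 * real u) * sqrt ?R)" for N u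
  let ?Q = "{(N, u). N \<le> t + 1 \<and> u \<le> N \<and> W N u = w}"
  have AJ: "?A z \<subseteq> ?J z" for z by auto
  have wt: "c * (\<Sum>h\<in>I. (if z h = 0 then 0 else ?R) + \<epsilon> * quad_char (z h) * sqrt ?R)
      = W (card (?J z)) (card (?A z))" for z
  proof -
    have "\<epsilon> * quad_char (z h) = 2 * (if \<epsilon> * quad_char (z h) = 1 then 1 else 0) - (if z h \<noteq> 0 then 1 else 0)" for h
      using quad_char_cases[of "z h"] \<epsilon> by (cases "z h = 0") auto
    then have "(\<Sum>h\<in>I. \<epsilon> * quad_char (z h))
      = (\<Sum>h\<in>I. 2 * (if \<epsilon> * quad_char (z h) = 1 then 1 else 0) - (if z h \<noteq> 0 then 1 else 0))"
      by (rule sum.cong[OF refl])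
    also have "\<dots> = 2 * real (card (?A z)) - real (card (?J z))"
      using fin by (simp add: sum_subtractf sum.If_cases Int_def Collect_neg_eq[symmetric] flip: sum_distrib_left)
    finally have 1: "(\<Sum>h\<in>I. \<epsilon> * quad_char (z h)) = \<dots>" .
    have 2: "(\<Sum>h\<in>I. if z h = 0 then 0 else ?R) = real (card (?J z)) * ?R"
      using fin by (simp add: sum.If_cases Int_def Collect_neg_eq[symmetric])
    show ?thesis
      unfolding W_def sum.distrib sum_distrib_right[symmetric] 1 2 by (simp add: algebra_simps)
  qed
  let ?S = "{z \<in> PiE I (\<lambda>_. UNIV :: 'r set). sum z I = 0 \<and> W (card (?J z)) (card (?A z)) = w}"
  have finS: "finite ?S" using fin by (auto simp: finite_PiE)
  have finQ: "finite ?Q" by (rule finite_subset[of _ "{..t+1} \<times> {..t+1}"]) auto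
  have "real (card ?S) = (\<Sum>z\<in>?S. 1)" by simp
  also have "\<dots> = (\<Sum>P\<in>?Q. \<Sum>z\<in>{z \<in> ?S. (card (?J z), card (?A z)) = P}. 1)"
  proof (rule sum.group[symmetric, OF finS finQ])
    have "card (?J z) \<le> t + 1" "card (?A z) \<le> card (?J z)" for z
      using fin card_I card_mono[of I "?J z"] card_mono[OF _ AJ] by auto
    then show "(\<lambda>z. (card (?J z), card (?A z))) ` ?S \<subseteq> ?Q" by auto
  qed
  also have "\<dots> = (\<Sum>(N, u)\<in>?Q. real ((t + 1) choose N) * real (N choose u) * class_count ?R N u)"
  proof (intro sum.cong refl)
    fix P assume "P \<in> ?Q"
    then obtain N u where P: "P = (N, u)" "W N u = w" by auto
    have "{z \<in> ?S. (card (?J z), card (?A z)) = P}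
        = {z \<in> PiE I (\<lambda>_. UNIV). sum z I = 0 \<and> card (?J z) = N \<and> card (?A z) = u}"
      using P by auto
    then show "(\<Sum>z\<in>{z \<in> ?S. (card (?J z), card (?A z)) = P}. 1)
        = (case P of (N, u) \<Rightarrow> real ((t + 1) choose N) * real (N choose u) * class_count ?R N u)"
      using card_zero_sums_of_type[OF fin \<epsilon>, of N u] P card_I by simp
  qed
  also have "\<dots> = (\<Sum>(N, u)\<in>{(N, u) \<in> ?Q. N \<ge> 2}. real ((t + 1) choose N) * real (N choose u) * class_count ?R N u)"
  proof (rule sum.mono_neutral_right[OF finQ])
    \<comment> \<open>\<open>N = 0\<close> would give weight 0, against \<open>w > 0\<close>; so
      among the pairs with \<open>N < 2\<close> only those with \<open>N = 1\<close> remain, and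
      their count is 0.\<close>
    have "N \<ge> 1" if "W N u = w" "u \<le> N" for N u
      using that \<open>w > 0\<close> by (cases N) (auto simp: W_def)
    then have N: "N = 1" if "(N, u) \<in> ?Q" "\<not> N \<ge> 2" for N u using that by force
    show "\<forall>P\<in>?Q - {(N, u) \<in> ?Q. N \<ge> 2}.
        (case P of (N, u) \<Rightarrow> real ((t + 1) choose N) * real (N choose u) * class_count ?R N u) = 0"
    proof
      fix P assume P: "P \<in> ?Q - {(N, u) \<in> ?Q. N \<ge> 2}"
      obtain N u where Nu: "P = (N, u)" by (cases P)
      with P have "N = 1" using N[of N u] by blast
      moreover have "u \<le> N" using P Nu by blast
      ultimately show "(case P of (N, u) \<Rightarrow>
          real ((t + 1) choose N) * real (N choose u) * class_count ?R N u) = 0"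
        using class_count_1[of u ?R] Nu by simp
    qed
  qed auto
  also have "\<dots> = (\<Sum>(k, u) | 1 \<le> k \<and> k \<le> t \<and> u \<le> k + 1 \<and> W (k + 1) u = w. freq (CARD('r)) t k u)"
    by (rule sum.reindex_bij_witness[of _ "\<lambda>(k, u). (k + 1, u)" "\<lambda>(N, u). (N - 1, u)"])
       (use card_gt1 in \<open>auto simp: freq_eq_class_count\<close>)
  finally show ?thesis unfolding wt by (simp add: W_def add.commute)
qed

end

section \<open>The weight distribution\<close>

lemma card_Collect_bij_betw:
  assumes "bij_betw f A B"
  shows "card {x \<in> A. P (f x)} = card {z \<in> B. P z}"
proof -
  have "f ` {x \<in> A. P (f x)} = {z \<in> B. P z}" using assms unfolding bij_betw_def by blast
  moreover have "inj_on f {x \<in> A. P (f x)}"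
    using assms unfolding bij_betw_def by (auto intro: inj_on_subset)
  ultimately show ?thesis by (metis card_image)
qed

section \<open>The discrete Fourier transform onto the zero-sum vectors\<close>

context almost_full_trace_code
begin

text \<open>\<open>e\<close> divides \<open>CARD('r) - 1\<close>, which is -1 in the field.\<close>

lemma e_nz: "(of_nat e :: 'r) \<noteq> 0"
proof
  assume "(of_nat e :: 'r) = 0"
  then have "(of_nat (CARD('r) - 1) :: 'r) = 0" by (simp only: L_eq of_nat_mult mult_zero_right)
  moreover have "of_nat (CARD('r) - 1) + 1 = (of_nat CARD('r) :: 'r)"
    using card_gt1 by (metis Suc_eq_plus1 Suc_pred' of_nat_1 of_nat_add zero_less_card_finite)
  ultimately show False by (simp add: of_nat_CARD_eq_0)
qed

lemma M_dvd_L_iff: "M dvd int L * c \<longleftrightarrow> int e dvd c"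
  using L_pos by (simp add: M_L)

text \<open>If \<open>e\<close> does not divide \<open>c\<close>, a shift of \<open>h\<close> by one
  multiplies the unchanged sum by \<open>\<gamma> powi (int L * c) \<noteq> 1\<close>, so it
  vanishes.\<close>

lemma sum_root_powers:
  "(\<Sum>h\<in>{0..<int e}. \<gamma> powi (int L * c * h)) = (if int e dvd c then of_nat e else 0)"
proof (cases "int e dvd c")
  case True
  have "\<gamma> powi (int L * c * h) = 1" for h
    using True by (simp only: powi_eq_1_iff mult.assoc M_dvd_L_iff) simp
  then show ?thesis using True by simp
next
  case False
  let ?F = "\<lambda>h. \<gamma> powi (int L * c * h)"
  let ?S = "\<Sum>h\<in>{0..<int e}. ?F h"
  have "?F (h mod int e) = ?F h" for h
  proof (rule powi_cong)
    have "int e dvd c * (h mod int e - h)" by (simp add: mod_eq_dvd_iff[symmetric])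
    then have "M dvd int L * (c * (h mod int e - h))" by (simp only: M_dvd_L_iff)
    then show "M dvd int L * c * (h mod int e) - int L * c * h" by (simp add: algebra_simps)
  qed
  then have "?S = (\<Sum>h\<in>{0..<int e}. ?F (h + 1))"
    using e_pos by (intro sum_periodic_shift[symmetric]) auto
  also have "\<dots> = (\<Sum>h\<in>{0..<int e}. \<gamma> powi (int L * c) * ?F h)"
    by (intro sum.cong refl, subst power_int_add[symmetric]) (simp_all add: algebra_simps)
  also have "\<dots> = \<gamma> powi (int L * c) * ?S" by (simp only: sum_distrib_left)
  finally have "(\<gamma> powi (int L * c) - 1) * ?S = 0" by (simp add: left_diff_distrib)
  moreover have "\<gamma> powi (int L * c) \<noteq> 1" using False by (simp only: powi_eq_1_iff M_dvd_L_iff) simp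
  ultimately show ?thesis using False by simp
qed

text \<open>By orthogonality only the summand \<open>j = i\<close> survives, the
  \<open>\<Delta> j\<close> being incongruent modulo \<open>e\<close>.\<close>

lemma fourier_inversion:
  assumes i: "i \<in> {1..t}"
  shows "(\<Sum>h\<in>{0..<int e}. \<gamma> powi (- (int L * \<Delta> i * h)) * y x h) = of_nat e * x i"
proof -
  have "\<gamma> powi (- (int L * \<Delta> i * h)) * y x h
      = (\<Sum>j=1..t. x j * \<gamma> powi (int L * (\<Delta> j - \<Delta> i) * h))" for h
  proof -
    have "\<gamma> powi (int L * (\<Delta> j - \<Delta> i) * h)
        = \<gamma> powi (- (int L * \<Delta> i * h)) * \<gamma> powi (int L * \<Delta> j * h)" for j
      by (subst power_int_add[symmetric]) (simp_all add: algebra_simps)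
    then show ?thesis by (simp add: y_def sum_distrib_left mult_ac)
  qed
  then have "(\<Sum>h\<in>{0..<int e}. \<gamma> powi (- (int L * \<Delta> i * h)) * y x h)
      = (\<Sum>h\<in>{0..<int e}. \<Sum>j=1..t. x j * \<gamma> powi (int L * (\<Delta> j - \<Delta> i) * h))"
    by simp
  also have "\<dots> = (\<Sum>j=1..t. x j * (\<Sum>h\<in>{0..<int e}. \<gamma> powi (int L * (\<Delta> j - \<Delta> i) * h)))"
    by (subst sum.swap) (simp add: sum_distrib_left)
  also have "\<dots> = (\<Sum>j=1..t. if j = i then of_nat e * x i else 0)"
    unfolding sum_root_powers
    using distinct_mod i by (intro sum.cong refl) (auto simp: cong_iff_dvd_diff)
  also have "\<dots> = of_nat e * x i" using i by simp
  finally show ?thesis .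
qed

text \<open>At most \<open>t = e - 1\<close> residues are taken, so one of the \<open>e\<close>
  classes stays free.\<close>

lemma missing_frequency: "\<exists>d. \<forall>j\<in>{1..t}. \<not> int e dvd \<Delta> j - d"
proof -
  have "card ((\<lambda>j. \<Delta> j mod int e) ` {1..t}) \<le> t"
    using card_image_le[of "{1..t}"] by simp
  then have "\<not> {0..<int e} \<subseteq> (\<lambda>j. \<Delta> j mod int e) ` {1..t}"
    using card_mono[of "(\<lambda>j. \<Delta> j mod int e) ` {1..t}" "{0..<int e}"] by (auto simp: e_eq)
  then obtain d where "d \<in> {0..<int e}" "d \<notin> (\<lambda>j. \<Delta> j mod int e) ` {1..t}" by blast
  then show ?thesis by (intro exI[of _ d]) (auto simp: mod_eq_dvd_iff[symmetric])
qed

text \<open>The entry at 0 is determined by the other \<open>e - 1 = t\<close> ones.\<close>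

lemma card_zero_sum_le:
  "card {z \<in> PiE {0..<int e} (\<lambda>_. UNIV :: 'r set). sum z {0..<int e} = 0} \<le> CARD('r) ^ t"
proof -
  let ?Z = "{z \<in> PiE {0..<int e} (\<lambda>_. UNIV :: 'r set). sum z {0..<int e} = 0}"
  have I: "{0..<int e} = insert 0 {1..<int e}" using e_pos by auto
  have "inj_on (\<lambda>z. restrict z {1..<int e}) ?Z"
  proof (rule inj_onI)
    fix z z' assume z: "z \<in> ?Z" "z' \<in> ?Z" and eq: "restrict z {1..<int e} = restrict z' {1..<int e}"
    have 1: "z h = z' h" if "h \<in> {1..<int e}" for h using fun_cong[OF eq, of h] that by simp
    then have "sum z {1..<int e} = sum z' {1..<int e}" by simp
    moreover have "z 0 + sum z {1..<int e} = 0" "z' 0 + sum z' {1..<int e} = 0"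
      using z unfolding I by simp_all
    ultimately have "z 0 = z' 0" by (metis add_right_cancel)
    then show "z = z'" using z 1 I by (intro PiE_ext[of z "{0..<int e}" "\<lambda>_. UNIV"]) auto
  qed
  moreover have "(\<lambda>z. restrict z {1..<int e}) ` ?Z \<subseteq> PiE {1..<int e} (\<lambda>_. UNIV)" by auto
  ultimately have "card ?Z \<le> card (PiE {1..<int e} (\<lambda>_. UNIV :: 'r set))"
    by (rule card_inj_on_le) (simp add: finite_PiE)
  also have "\<dots> = CARD('r) ^ t" by (simp add: card_PiE e_eq)
  finally show ?thesis .
qed

text \<open>Twisting \<open>y x\<close> by the missing frequency \<open>d\<close> shifts every
  frequency to \<open>\<Delta> j - d\<close>, none of which is 0 modulo \<open>e\<close>, so the sum
  over \<open>h\<close> vanishes. Inversion gives injectivity, and comparison with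
  \<open>CARD('r) ^ t\<close> gives surjectivity. The twisting factors are squares because
  \<open>L\<close> is even.\<close>

lemma fourier_bij:
  "\<exists>Z. bij_betw Z (tuples t) {z \<in> PiE {0..<int e} (\<lambda>_. UNIV :: 'r set). sum z {0..<int e} = 0} \<and>
    (\<forall>x. \<forall>h\<in>{0..<int e}. (Z x h = 0 \<longleftrightarrow> y x h = 0) \<and> quad_char (Z x h) = quad_char (y x h))"
proof -
  obtain d where d: "\<And>j. j \<in> {1..t} \<Longrightarrow> \<not> int e dvd \<Delta> j - d" using missing_frequency by blast
  define Z where "Z x = restrict (\<lambda>h. \<gamma> powi (- (int L * d * h)) * y x h) {0..<int e}" for x
  let ?H = "{z \<in> PiE {0..<int e} (\<lambda>_. UNIV :: 'r set). sum z {0..<int e} = 0}"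
  have inj: "inj_on Z (tuples t)"
  proof (rule inj_onI)
    fix x x' :: "nat \<Rightarrow> 'r" assume x: "x \<in> tuples t" "x' \<in> tuples t" and "Z x = Z x'"
    then have eq: "Z x h = Z x' h" for h by simp
    have y: "y x h = y x' h" if "h \<in> {0..<int e}" for h
      using eq[of h] that by (simp add: Z_def)
    have "x i = x' i" if "i \<in> {1..t}" for i
    proof -
      have "of_nat e * x i = of_nat e * x' i"
        unfolding fourier_inversion[OF that, symmetric] using y by simp
      then show ?thesis using e_nz by simp
    qed
    then show "x = x'" using x unfolding tuples_def by (intro PiE_ext) auto
  qed
  have "Z x \<in> ?H" for x
  proof -
    have "\<gamma> powi (- (int L * d * h)) * y x h = (\<Sum>j=1..t. x j * \<gamma> powi (int L * (\<Delta> j - d) * h))" for h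
    proof -
      have "\<gamma> powi (int L * (\<Delta> j - d) * h) = \<gamma> powi (- (int L * d * h)) * \<gamma> powi (int L * \<Delta> j * h)" for j
        by (subst power_int_add[symmetric]) (simp_all add: algebra_simps)
      then show ?thesis by (simp add: y_def sum_distrib_left mult_ac)
    qed
    then have "sum (Z x) {0..<int e} = (\<Sum>h\<in>{0..<int e}. \<Sum>j=1..t. x j * \<gamma> powi (int L * (\<Delta> j - d) * h))"
      by (simp add: Z_def)
    also have "\<dots> = (\<Sum>j=1..t. x j * (\<Sum>h\<in>{0..<int e}. \<gamma> powi (int L * (\<Delta> j - d) * h)))"
      by (subst sum.swap) (simp add: sum_distrib_left)
    also have "\<dots> = 0" unfolding sum_root_powers using d by (intro sum.neutral) auto
    finally show ?thesis by (simp add: Z_def)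
  qed
  then have sub: "Z ` tuples t \<subseteq> ?H" by blast
  have "card (Z ` tuples t) = CARD('r) ^ t"
    by (simp add: card_image[OF inj]) (simp add: tuples_def card_PiE)
  then have "Z ` tuples t = ?H"
    using card_zero_sum_le by (intro card_seteq[OF _ sub]) (simp_all add: finite_PiE)
  with inj have "bij_betw Z (tuples t) ?H" by (simp add: bij_betw_def)
  moreover have "(Z x h = 0 \<longleftrightarrow> y x h = 0) \<and> quad_char (Z x h) = quad_char (y x h)"
    if "h \<in> {0..<int e}" for x h
  proof -
    have "even (- (int L * d * h))" using even_L by simp
    then have "quad_char (\<gamma> powi (- (int L * d * h))) = 1" by (simp only: quad_char_powi) simp
    then show ?thesis using that by (simp add: Z_def quad_char_mult)
  qed
  ultimately show ?thesis by blast
qed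

text \<open>The unknown sign of \<open>weight_formula\<close> disappears here: \<open>u\<close>
  counts the coordinates on which \<open>\<epsilon> * quad_char\<close> is 1, and the distribution
  of these counts is the same for both signs.\<close>

lemma weight_distribution:
  assumes "w > 0"
  shows "real (card {x \<in> tuples t. real (hamming_weight n (codeword \<iota> m \<gamma> n t as x)) = w})
    = (\<Sum>(k, u) | 1 \<le> k \<and> k \<le> t \<and> u \<le> k + 1 \<and> weight1 q (CARD('r)) t \<delta> k u = w.
        freq (CARD('r)) t k u)"
proof -
  let ?R = "real CARD('r)" and ?c = "(real q - 1) / (real e * real q * real \<delta>)" and ?I = "{0..<int e}"
  obtain \<epsilon> where \<epsilon>: "\<epsilon> = 1 \<or> \<epsilon> = -1"
    and wt: "\<And>x. real (hamming_weight n (codeword \<iota> m \<gamma> n t as x)) =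
     ?c * (\<Sum>h\<in>?I. (if y x h = 0 then 0 else ?R) + \<epsilon> * quad_char (y x h) * sqrt ?R)"
    using weight_formula by blast
  let ?wt = "\<lambda>z::int \<Rightarrow> 'r. ?c * (\<Sum>h\<in>?I. (if z h = 0 then 0 else ?R) + \<epsilon> * quad_char (z h) * sqrt ?R)"
  let ?H = "{z \<in> PiE ?I (\<lambda>_. UNIV :: 'r set). sum z ?I = 0}"
  obtain Z where Z: "bij_betw Z (tuples t) ?H"
    and ZY: "\<And>x h. h \<in> ?I \<Longrightarrow> (Z x h = 0 \<longleftrightarrow> y x h = 0) \<and> quad_char (Z x h) = quad_char (y x h)"
    using fourier_bij by blast
  have wtZ: "real (hamming_weight n (codeword \<iota> m \<gamma> n t as x)) = ?wt (Z x)" for x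
    unfolding wt using ZY by (intro arg_cong2[where f = "(*)"] refl sum.cong) auto
  have c1: "card {x \<in> tuples t. ?wt (Z x) = w} = card {z \<in> ?H. ?wt z = w}"
    using Z by (rule card_Collect_bij_betw)
  have c2: "{z \<in> ?H. ?wt z = w} = {z \<in> PiE ?I (\<lambda>_. UNIV). sum z ?I = 0 \<and> ?wt z = w}" by blast
  have c3: "real (card {z \<in> PiE ?I (\<lambda>_. UNIV). sum z ?I = 0 \<and> ?wt z = w}) = (\<Sum>(k, u) | 1 \<le> k \<and> k \<le> t \<and> u \<le> k + 1 \<and>
        ?c * ((real k + 1) * ?R - (real k + 1 - 2 * real u) * sqrt ?R) = w. freq (CARD('r)) t k u)"
    by (rule weight_distribution_zero_sums[OF _ _ \<epsilon> assms]) (simp_all add: e_eq)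
  have t: "real t + 1 = real e" by (simp add: e_eq)
  show ?thesis unfolding wtZ c1 c2 c3 weight1_def t ..
qed

text \<open>With R for \<open>CARD('r)\<close>, a nonzero \<open>y x h\<close> contributes at least
  R - sqrt R > 0 to the sum, so weight 0 makes all of them vanish and inversion applies.\<close>

lemma weight_eq_0_imp:
  assumes "hamming_weight n (codeword \<iota> m \<gamma> n t as x) = 0" "i \<in> {1..t}"
  shows "x i = 0"
proof -
  let ?R = "real CARD('r)" and ?c = "(real q - 1) / (real e * real q * real \<delta>)"
  obtain \<epsilon> where \<epsilon>: "\<epsilon> = 1 \<or> \<epsilon> = -1"
    and wt: "\<And>x. real (hamming_weight n (codeword \<iota> m \<gamma> n t as x)) =
     ?c * (\<Sum>h\<in>{0..<int e}. (if y x h = 0 then 0 else ?R) + \<epsilon> * quad_char (y x h) * sqrt ?R)"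
    using weight_formula by blast
  define S where "S = sqrt ?R"
  have "sqrt ?R * 1 < sqrt ?R * sqrt ?R" using card_gt1 by (intro mult_strict_left_mono) auto
  then have S: "S < ?R" "S > 0" using card_gt1 by (auto simp: S_def)
  let ?f = "\<lambda>z::'r. (if z = 0 then 0 else ?R) + \<epsilon> * quad_char z * S"
  have unit: "\<epsilon> * quad_char z = 1 \<or> \<epsilon> * quad_char z = -1" if "z \<noteq> 0" for z :: 'r
    using quad_char_cases[OF that] \<epsilon> by auto
  have f_pos: "?f z > 0" if "z \<noteq> 0" for z
    using unit[OF that] S that by (auto simp del: mult_eq_1_iff)
  then have nonneg: "?f z \<ge> 0" for z by (cases "z = 0") (auto intro: less_imp_le)
  have c: "?c \<noteq> 0" using q_gt1 e_pos delta_pos by simp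
  have "?c * (\<Sum>h\<in>{0..<int e}. ?f (y x h)) = 0"
    unfolding S_def wt[symmetric] assms(1) by simp
  then have "?c = 0 \<or> (\<Sum>h\<in>{0..<int e}. ?f (y x h)) = 0" by (simp only: mult_eq_0_iff)
  with c have "(\<Sum>h\<in>{0..<int e}. ?f (y x h)) = 0" by blast
  then have "\<forall>h\<in>{0..<int e}. ?f (y x h) = 0"
    by (subst (asm) sum_nonneg_eq_0_iff) (simp_all add: nonneg del: add_eq_0_iff)
  then have "y x h = 0" if "h \<in> {0..<int e}" for h using f_pos[of "y x h"] that by fastforce
  then have "of_nat e * x i = 0"
    unfolding fourier_inversion[OF assms(2), symmetric] by simp
  then show ?thesis using e_nz by simp
qed

section \<open>Linearity, injectivity and cyclic shifts of the encoding\<close>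

lemma codeword_add:
  "codeword \<iota> m \<gamma> n t as x + codeword \<iota> m \<gamma> n t as x'
   = codeword \<iota> m \<gamma> n t as (restrict (\<lambda>j. x j + x' j) {1..t})"
proof
  fix i
  have "(\<Sum>j=1..t. (x j + x' j) * \<gamma> powi (as j * int i))
      = (\<Sum>j=1..t. x j * \<gamma> powi (as j * int i)) + (\<Sum>j=1..t. x' j * \<gamma> powi (as j * int i))"
    by (simp only: distrib_right sum.distrib)
  then show "(codeword \<iota> m \<gamma> n t as x + codeword \<iota> m \<gamma> n t as x') i
      = codeword \<iota> m \<gamma> n t as (restrict (\<lambda>j. x j + x' j) {1..t}) i"
    by (simp add: codeword_def trace_add)
qed

lemma codeword_scale:
  "scale_word c (codeword \<iota> m \<gamma> n t as x)
   = codeword \<iota> m \<gamma> n t as (restrict (\<lambda>j. \<iota> c * x j) {1..t})"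
proof
  fix i
  have "(\<Sum>j=1..t. \<iota> c * x j * \<gamma> powi (as j * int i)) = \<iota> c * (\<Sum>j=1..t. x j * \<gamma> powi (as j * int i))"
    by (simp add: sum_distrib_left mult.assoc)
  then show "scale_word c (codeword \<iota> m \<gamma> n t as x) i
      = codeword \<iota> m \<gamma> n t as (restrict (\<lambda>j. \<iota> c * x j) {1..t}) i"
    by (simp add: scale_word_def codeword_def trace_scale)
qed

lemma codeword_zero: "codeword \<iota> m \<gamma> n t as (restrict (\<lambda>_. 0) {1..t}) = 0"
proof
  fix i
  have "field_trace \<iota> m 0 = 0" by (simp add: trace_eq_0_iff)
  then show "codeword \<iota> m \<gamma> n t as (restrict (\<lambda>_. 0) {1..t}) i = 0 i"
    by (simp add: codeword_def)
qed

lemma restrict_in_tuples: "restrict x {1..t} \<in> tuples t"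
  by (simp add: tuples_def)

lemma subspace_code: "word_space.subspace (trace_code \<iota> m \<gamma> n t as)"
  unfolding word_space.subspace_def trace_code_def
proof (intro conjI ballI allI)
  show "0 \<in> codeword \<iota> m \<gamma> n t as ` tuples t"
    unfolding codeword_zero[symmetric] using restrict_in_tuples by blast
next
  fix v w assume "v \<in> codeword \<iota> m \<gamma> n t as ` tuples t" "w \<in> codeword \<iota> m \<gamma> n t as ` tuples t"
  then show "v + w \<in> codeword \<iota> m \<gamma> n t as ` tuples t"
    using codeword_add restrict_in_tuples by blast
next
  fix c v assume "v \<in> codeword \<iota> m \<gamma> n t as ` tuples t"
  then show "scale_word c v \<in> codeword \<iota> m \<gamma> n t as ` tuples t"
    using codeword_scale restrict_in_tuples by blast
qed

lemma inj_codeword: "inj_on (codeword \<iota> m \<gamma> n t as) (tuples t)"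
proof (rule inj_onI)
  let ?C = "codeword \<iota> m \<gamma> n t as"
  fix x x' assume x: "x \<in> tuples t" "x' \<in> tuples t" and eq: "?C x = ?C x'"
  \<comment> \<open>The difference of \<open>x\<close> and \<open>x'\<close>, in the nested form
    produced by \<open>codeword_scale\<close> and \<open>codeword_add\<close>.\<close>
  let ?x = "restrict (\<lambda>j. x j + restrict (\<lambda>j. \<iota> (- 1) * x' j) {1..t} j) {1..t}"
  have "?C ?x = ?C x + scale_word (- 1) (?C x')" by (simp only: codeword_add codeword_scale)
  also have "\<dots> = 0" using eq by (auto simp: scale_word_def fun_eq_iff)
  finally have "hamming_weight n (?C ?x) = 0" by (simp add: hamming_weight_def)
  then have "?x i = 0" if "i \<in> {1..t}" for i using weight_eq_0_imp that by blast
  then have "x i = x' i" if "i \<in> {1..t}" for i using that by (force simp: iota_minus)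
  then show "x = x'" using x unfolding tuples_def by (intro PiE_ext) auto
qed

lemma card_tuples: "card (tuples t :: (nat \<Rightarrow> 'r) set) = q ^ (t * m)"
proof -
  have "card (tuples t :: (nat \<Rightarrow> 'r) set) = (q ^ m) ^ t" by (simp add: tuples_def card_PiE card_r)
  then show ?thesis by (simp only: power_mult[symmetric] mult.commute)
qed

lemma card_code: "card (trace_code \<iota> m \<gamma> n t as) = q ^ (t * m)"
  unfolding trace_code_def by (simp only: card_image[OF inj_codeword] card_tuples)

text \<open>Going back one position multiplies the \<open>j\<close>-th term by
  \<open>\<gamma> powi (- as j)\<close>; position 0 wraps around correctly because
  \<open>f x\<close> has period \<open>n\<close>.\<close>

lemma cyclic_shift_codeword:
  "cyclic_shift n (codeword \<iota> m \<gamma> n t as x)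
   = codeword \<iota> m \<gamma> n t as (restrict (\<lambda>j. x j * \<gamma> powi (- as j)) {1..t})"
proof
  fix i
  let ?x = "restrict (\<lambda>j. x j * \<gamma> powi (- as j)) {1..t}"
  show "cyclic_shift n (codeword \<iota> m \<gamma> n t as x) i = codeword \<iota> m \<gamma> n t as ?x i"
  proof (cases "i < n")
    case True
    have "int ((i + n - 1) mod n) = (int i - 1) mod int n"
      using n_pos by (simp add: zmod_int of_nat_diff algebra_simps)
        (metis add.commute diff_add_eq mod_add_self2)
    then have "f x (int ((i + n - 1) mod n)) = f x (int i - 1)" by (simp add: f_mod_n)
    also have "\<dots> = f ?x (int i)"
    proof -
      have "\<gamma> powi (as j * (int i - 1)) = \<gamma> powi (- as j) * \<gamma> powi (as j * int i)" for j
        by (subst power_int_add[symmetric]) (simp_all add: algebra_simps)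
      then show ?thesis by (simp add: f_def mult.assoc)
    qed
    finally show ?thesis using True n_pos by (simp add: cyclic_shift_def codeword_nth)
  qed (simp add: cyclic_shift_def codeword_def)
qed

end

text \<open>Coordinates with respect to a basis give the bijection; the equation serves to read the
  dimension off the number of codewords.\<close>

lemma card_subspace:
  fixes C :: "(nat \<Rightarrow> 'q::{field,finite}) set"
  assumes "word_space.subspace C" "finite C"
  shows "card C = CARD('q) ^ word_space.dim C"
proof -
  obtain B where B: "B \<subseteq> C" "word_space.independent B" "C \<subseteq> word_space.span B" "card B = word_space.dim C"
    using word_space.basis_exists by blast
  have fin: "finite B" using B(1) assms(2) by (rule finite_subset)
  have C: "C = word_space.span B"
    using B assms(1) by (simp add: subset_antisym word_space.span_minimal)
  let ?g = "\<lambda>u. \<Sum>v\<in>B. scale_word (u v) v"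
  have "inj_on ?g (PiE B (\<lambda>_. UNIV))"
  proof (rule inj_onI)
    fix u u' :: "(nat \<Rightarrow> 'q) \<Rightarrow> 'q"
    assume u: "u \<in> PiE B (\<lambda>_. UNIV)" "u' \<in> PiE B (\<lambda>_. UNIV)" and "?g u = ?g u'"
    then have "(\<Sum>v\<in>B. scale_word (u v - u' v) v) = 0"
      by (simp add: word_space.scale_left_diff_distrib sum_subtractf)
    then have "u v - u' v = 0" if "v \<in> B" for v
      using that by (rule word_space.independentD[OF B(2) fin order.refl])
    then show "u = u'" using u by (intro PiE_ext) auto
  qed
  moreover have "?g ` PiE B (\<lambda>_. UNIV) = C"
  proof -
    have "range ?g \<subseteq> ?g ` PiE B (\<lambda>_. UNIV)"
    proof (rule image_subsetI)
      fix u :: "(nat \<Rightarrow> 'q) \<Rightarrow> 'q"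
      have eq: "?g u = ?g (restrict u B)" by (intro sum.cong) auto
      have "restrict u B \<in> PiE B (\<lambda>_. UNIV)" by simp
      then have "?g (restrict u B) \<in> ?g ` PiE B (\<lambda>_. UNIV)" by (rule imageI)
      then show "?g u \<in> ?g ` PiE B (\<lambda>_. UNIV)" unfolding eq .
    qed
    moreover have "?g ` PiE B (\<lambda>_. UNIV) \<subseteq> range ?g" by (rule image_mono) simp
    ultimately show ?thesis unfolding C word_space.span_finite[OF fin] by (rule equalityI[rotated])
  qed
  ultimately have "card C = card (PiE B (\<lambda>_. UNIV :: 'q set))" using card_image by blast
  then show ?thesis using fin B(4) by (simp add: card_PiE)
qed

section \<open>Parameters of the code\<close>

text \<open>Differences of codewords are codewords, so distances are weights; \<open>d\<close> is
  attained between \<open>v\<close> and 0.\<close>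

lemma min_distance_subspace:
  assumes "word_space.subspace C"
    and "v \<in> C" "v \<noteq> 0" "hamming_weight n v = d"
    and least: "\<And>w. w \<in> C \<Longrightarrow> w \<noteq> 0 \<Longrightarrow> d \<le> hamming_weight n w"
  shows "min_distance n C = d"
  unfolding min_distance_def
proof (rule cInf_eq_minimum)
  have dist: "hamming_dist n x y = hamming_weight n (x - y)" for x y :: "nat \<Rightarrow> 'a"
    by (simp add: hamming_dist_def hamming_weight_def)
  have "hamming_dist n v 0 = d" by (simp add: dist assms(4))
  moreover have "0 \<in> C" using assms(1) by (rule word_space.subspace_0)
  ultimately show "d \<in> {hamming_dist n v w |v w. v \<in> C \<and> w \<in> C \<and> v \<noteq> w}"
    using assms(2,3) by blast
  fix j assume "j \<in> {hamming_dist n v w |v w. v \<in> C \<and> w \<in> C \<and> v \<noteq> w}"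
  then obtain x y where xy: "j = hamming_dist n x y" "x \<in> C" "y \<in> C" "x \<noteq> y" by blast
  then have "x - y \<in> C" "x - y \<noteq> 0" using word_space.subspace_diff[OF assms(1)] by auto
  then show "d \<le> j" unfolding xy(1) dist by (rule least)
qed

section \<open>Identities for the frequencies and weights\<close>

lemma freq_reflect:
  assumes "u \<le> k + 1"
  shows "freq r t k (k + 1 - u) = freq r t k u"
proof -
  have "(k + 1) choose (k + 1 - u) = (k + 1) choose u"
    using assms by (rule binomial_symmetric[symmetric])
  moreover have "k + 1 - (k + 1 - u) = u" using assms by simp
  ultimately show ?thesis by (simp only: freq_def add.commute mult.commute)
qed

text \<open>Behind the cancellation: two nonzero entries of sum 0 are \<open>z\<close> and
  \<open>- z\<close>, which lie in the same class when -1 is a square, so exactly one of them cannot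
  be in a given class.\<close>

lemma freq_1_1: "freq r t 1 1 = 0"
proof -
  have "sqrt (real r) * sqrt (real r) = real r" by simp
  then have "2 * (real r - 1) ^ 1 - (-1) ^ 1 * ((1 + sqrt (real r)) ^ 1 * (1 - sqrt (real r)) ^ (1 + 1 - 1)
      + (1 - sqrt (real r)) ^ 1 * (1 + sqrt (real r)) ^ (1 + 1 - 1)) = 0"
    by (simp add: algebra_simps)
  then show ?thesis unfolding freq_def by (simp only: mult_zero_right)
qed

text \<open>For \<open>k = 1\<close> and \<open>u = 0\<close> both products are squares, and the
  sign \<open>(-1) ^ k\<close> makes them nonnegative contributions to the bracket.\<close>

lemma freq_1_0:
  assumes "r > 1" "t \<ge> 1" shows "freq r t 1 0 > 0"
proof -
  have "2 * (real r - 1) ^ 1 - (-1) ^ 1 * ((1 + sqrt (real r)) ^ 0 * (1 - sqrt (real r)) ^ (1 + 1 - 0)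
      + (1 - sqrt (real r)) ^ 0 * (1 + sqrt (real r)) ^ (1 + 1 - 0)) > 0"
  proof -
    have "- A - B < 2 * real r - 2" if "A \<ge> 0" "B \<ge> 0" for A B
      using that assms(1) by simp
    then show ?thesis by simp
  qed
  moreover have "((t + 1) choose (1 + 1)) > 0" using assms(2) by (intro zero_less_binomial) simp
  ultimately show ?thesis unfolding freq_def using assms(1) by (intro mult_pos_pos) auto
qed

lemma weight1_diff:
  "weight1 q r t \<delta> k u - weight1 q r t \<delta> 1 0 = (real q - 1) / ((real t + 1) * real q * real \<delta>) *
     ((real k - 1) * (real r - sqrt (real r)) + 2 * real u * sqrt (real r))"
  unfolding weight1_def right_diff_distrib[symmetric] by (simp add: algebra_simps)

lemma sqrt_less_self: "(r::real) > 1 \<Longrightarrow> sqrt r < r"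
  using mult_strict_left_mono[of 1 "sqrt r" "sqrt r"] by simp

text \<open>Both summands in \<open>weight1_diff\<close> are nonnegative since
  \<open>sqrt r < r\<close>. The second part isolates the pair \<open>(1, 0)\<close>, so that its
  frequency alone counts the words of minimal weight.\<close>

lemma weight1_ge:
  assumes "q > 1" "r > 1" "\<delta> > 0" "k \<ge> 1"
  shows "weight1 q r t \<delta> k u \<ge> weight1 q r t \<delta> 1 0"
    and "weight1 q r t \<delta> k u = weight1 q r t \<delta> 1 0 \<longleftrightarrow> k = 1 \<and> u = 0"
proof -
  let ?c = "(real q - 1) / ((real t + 1) * real q * real \<delta>)"
  let ?A = "(real k - 1) * (real r - sqrt (real r))" and ?B = "2 * real u * sqrt (real r)"
  have c: "?c > 0" using assms by simp
  have s: "real r - sqrt (real r) > 0" using assms sqrt_less_self[of "real r"] by simp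
  have AB: "?A \<ge> 0" "?B \<ge> 0" using assms s by (auto intro!: mult_nonneg_nonneg)
  then have "?c * (?A + ?B) \<ge> 0" using c by (intro mult_nonneg_nonneg) auto
  then show "weight1 q r t \<delta> k u \<ge> weight1 q r t \<delta> 1 0" using weight1_diff[of q r t \<delta> k u] by linarith
  have "weight1 q r t \<delta> k u = weight1 q r t \<delta> 1 0 \<longleftrightarrow> ?c * (?A + ?B) = 0"
    using weight1_diff[of q r t \<delta> k u] by linarith
  also have "\<dots> \<longleftrightarrow> ?A + ?B = 0" using c by (simp only: mult_eq_0_iff) auto
  also have "\<dots> \<longleftrightarrow> ?A = 0 \<and> ?B = 0" using AB by linarith
  also have "\<dots> \<longleftrightarrow> k = 1 \<and> u = 0"
  proof -
    have "?A = 0 \<longleftrightarrow> k = 1" using s assms by (simp only: mult_eq_0_iff) auto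
    moreover have "?B = 0 \<longleftrightarrow> u = 0" using assms by simp
    ultimately show ?thesis by simp
  qed
  finally show "weight1 q r t \<delta> k u = weight1 q r t \<delta> 1 0 \<longleftrightarrow> k = 1 \<and> u = 0" .
qed

lemma weight1_1_0:
  "weight1 q r t \<delta> 1 0 = 2 * (real q - 1) * (real r - sqrt (real r)) / ((real t + 1) * real q * real \<delta>)"
  by (simp add: weight1_def algebra_simps)

text \<open>For odd \<open>m div 2\<close> the reflection \<open>u \<mapsto> k + 1 - u\<close>
  exchanges the two weight functions and preserves \<open>freq\<close>; for even
  \<open>m div 2\<close> they coincide.\<close>

lemma weight3_sum_eq:
  "(\<Sum>(k, u) | 1 \<le> k \<and> k \<le> t \<and> u \<le> k + 1 \<and> weight3 q m r t \<delta> k u = w. freq r t k u)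
   = (\<Sum>(k, u) | 1 \<le> k \<and> k \<le> t \<and> u \<le> k + 1 \<and> weight1 q r t \<delta> k u = w. freq r t k u)"
proof (cases "even (m div 2)")
  case True
  then have "weight3 q m r t \<delta> k u = weight1 q r t \<delta> k u" for k u
    by (simp add: weight3_def weight1_def)
  then show ?thesis by simp
next
  case False
  have w: "weight1 q r t \<delta> k (k + 1 - u) = weight3 q m r t \<delta> k u" if "u \<le> k + 1" for k u
  proof -
    have "real k + 1 - 2 * real (k + 1 - u) = - (real k + 1 - 2 * real u)" using that by (simp add: of_nat_diff)
    then show ?thesis using False unfolding weight3_def weight1_def by simp
  qed
  have w': "weight3 q m r t \<delta> k (k + 1 - u) = weight1 q r t \<delta> k u" if "u \<le> k + 1" for k u
    using w[of "k + 1 - u" k] that by simp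
  show ?thesis
    by (rule sum.reindex_bij_witness[of _ "\<lambda>(k, u). (k, k + 1 - u)" "\<lambda>(k, u). (k, k + 1 - u)"])
       (use w w' freq_reflect in \<open>auto simp del: diff_Suc_eq_diff_pred\<close>)
qed

lemma card_index_pairs:
  "2 * card {(k, u). 1 \<le> k \<and> k \<le> t \<and> u \<le> k + (1::nat)} = t ^ 2 + 5 * t"
proof -
  have "{(k, u). 1 \<le> k \<and> k \<le> t \<and> u \<le> k + 1} = (SIGMA k:{1..t}. {..k + 1})" by auto
  then have "card {(k, u). 1 \<le> k \<and> k \<le> t \<and> u \<le> k + 1} = (\<Sum>k=1..t. k + 2)" by simp
  moreover have "2 * (\<Sum>k=1..t. k + 2) = t ^ 2 + 5 * t"
    by (induction t) (simp_all add: power2_eq_square)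
  ultimately show ?thesis by simp
qed

section \<open>Dimension, minimum distance and number of weights\<close>

context almost_full_trace_code
begin

lemma codeword_in_words: "codeword \<iota> m \<gamma> n t as x \<in> words n"
  by (simp add: words_def codeword_def)

lemma finite_code: "finite (trace_code \<iota> m \<gamma> n t as)"
  by (simp add: trace_code_def tuples_def finite_PiE)

lemma cyclic_trace_code: "cyclic_code n (t * m) (trace_code \<iota> m \<gamma> n t as)"
proof -
  let ?C = "trace_code \<iota> m \<gamma> n t as"
  have "q ^ word_space.dim ?C = q ^ (t * m)"
    using card_subspace[OF subspace_code finite_code] by (simp only: card_q card_code)
  then have "word_space.dim ?C = t * m" using q_gt1 by (simp only: power_inject_exp)
  moreover have "?C \<subseteq> words n" using codeword_in_words by (auto simp: trace_code_def)
  moreover have "cyclic_shift n c \<in> ?C" if "c \<in> ?C" for c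
    using that cyclic_shift_codeword restrict_in_tuples unfolding trace_code_def by blast
  ultimately show ?thesis by (simp add: cyclic_code_def linear_code_def subspace_code)
qed

lemma zero_weight_tuples:
  "{x \<in> tuples t. hamming_weight n (codeword \<iota> m \<gamma> n t as x) = 0} = {restrict (\<lambda>_. 0) {1..t}}"
proof (intro equalityI subsetI)
  fix x assume "x \<in> {x \<in> tuples t. hamming_weight n (codeword \<iota> m \<gamma> n t as x) = 0}"
  then have x: "x \<in> tuples t" "hamming_weight n (codeword \<iota> m \<gamma> n t as x) = 0" by auto
  then have "x i = restrict (\<lambda>_. 0) {1..t} i" if "i \<in> {1..t}" for i
    using weight_eq_0_imp[OF x(2) that] that by simp
  then have "x = restrict (\<lambda>_. 0) {1..t}"
    using x(1) restrict_in_tuples unfolding tuples_def by (intro PiE_ext) auto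
  then show "x \<in> {restrict (\<lambda>_. 0) {1..t}}" by simp
next
  fix x :: "nat \<Rightarrow> 'r" assume "x \<in> {restrict (\<lambda>_. 0) {1..t}}"
  then have x: "x = restrict (\<lambda>_. 0) {1..t}" by simp
  have "hamming_weight n (codeword \<iota> m \<gamma> n t as x) = 0"
    unfolding x codeword_zero by (simp add: hamming_weight_def)
  then show "x \<in> {x \<in> tuples t. hamming_weight n (codeword \<iota> m \<gamma> n t as x) = 0}"
    using restrict_in_tuples by (simp add: x)
qed

text \<open>A nonempty weight class makes the sum of frequencies nonzero, so some term of it is
  nonzero.\<close>

lemma weight_occurs:
  assumes "x \<in> tuples t" "hamming_weight n (codeword \<iota> m \<gamma> n t as x) \<noteq> 0"
  obtains k u where "1 \<le> k" "k \<le> t" "u \<le> k + 1"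
    "real (hamming_weight n (codeword \<iota> m \<gamma> n t as x)) = weight1 q (CARD('r)) t \<delta> k u"
    "freq (CARD('r)) t k u \<noteq> 0"
proof -
  let ?w = "real (hamming_weight n (codeword \<iota> m \<gamma> n t as x))"
  let ?X = "{x' \<in> tuples t. real (hamming_weight n (codeword \<iota> m \<gamma> n t as x')) = ?w}"
  have "finite ?X" by (simp add: tuples_def finite_PiE)
  then have "card ?X \<noteq> 0" using assms(1) by (subst card_0_eq) auto
  then have "(\<Sum>(k, u) | 1 \<le> k \<and> k \<le> t \<and> u \<le> k + 1 \<and> weight1 q (CARD('r)) t \<delta> k u = ?w.
        freq (CARD('r)) t k u) \<noteq> 0"
    using weight_distribution[of ?w] assms(2) by simp
  then obtain P where "P \<in> {(k, u). 1 \<le> k \<and> k \<le> t \<and> u \<le> k + 1 \<and> weight1 q (CARD('r)) t \<delta> k u = ?w}"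
    "(case P of (k, u) \<Rightarrow> freq (CARD('r)) t k u) \<noteq> 0"
    by (rule sum.not_neutral_contains_not_neutral)
  then show ?thesis using that by (cases P) auto
qed

text \<open>The pair \<open>(1, 0)\<close> has the smallest weight, shares it with no other pair,
  and has positive frequency, so the bound is attained.\<close>

lemma min_distance_trace_code:
  assumes "t \<ge> 1"
  shows "real (min_distance n (trace_code \<iota> m \<gamma> n t as)) = weight1 q (CARD('r)) t \<delta> 1 0"
proof -
  let ?C = "codeword \<iota> m \<gamma> n t as" and ?w = "weight1 q (CARD('r)) t \<delta> 1 0"
  have "sqrt (real CARD('r)) < real CARD('r)" using card_gt1 by (intro sqrt_less_self) simp
  then have "?w > 0"
    unfolding weight1_1_0 using q_gt1 delta_pos by simp
  have P: "{(k, u). 1 \<le> k \<and> k \<le> t \<and> u \<le> k + 1 \<and> weight1 q (CARD('r)) t \<delta> k u = ?w} = {(1, 0)}"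
    using weight1_ge(2)[OF q_gt1 card_gt1 delta_pos] assms by auto
  have "real (card {x \<in> tuples t. real (hamming_weight n (?C x)) = ?w}) > 0"
    unfolding weight_distribution[OF \<open>?w > 0\<close>] P using freq_1_0[OF card_gt1 assms] by simp
  then have "{x \<in> tuples t. real (hamming_weight n (?C x)) = ?w} \<noteq> {}" by (metis card.empty less_irrefl of_nat_0)
  then obtain x where x: "x \<in> tuples t" "real (hamming_weight n (?C x)) = ?w" by blast
  have "min_distance n (trace_code \<iota> m \<gamma> n t as) = hamming_weight n (?C x)"
  proof (rule min_distance_subspace[OF subspace_code])
    show "?C x \<in> trace_code \<iota> m \<gamma> n t as" using x(1) by (simp add: trace_code_def)
    show "?C x \<noteq> 0" using x(2) \<open>?w > 0\<close> by (auto simp: hamming_weight_def)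
    fix v assume "v \<in> trace_code \<iota> m \<gamma> n t as" "v \<noteq> 0"
    then obtain x' where x': "x' \<in> tuples t" "v = ?C x'" by (auto simp: trace_code_def)
    have "hamming_weight n v \<noteq> 0"
    proof
      assume "hamming_weight n v = 0"
      then have "x' \<in> {x \<in> tuples t. hamming_weight n (?C x) = 0}" using x' by simp
      then have "x' = restrict (\<lambda>_. 0) {1..t}" unfolding zero_weight_tuples by simp
      then show False using x'(2) \<open>v \<noteq> 0\<close> codeword_zero by simp
    qed
    then obtain k u where "1 \<le> k" "real (hamming_weight n v) = weight1 q (CARD('r)) t \<delta> k u"
      using weight_occurs[OF x'(1)] unfolding x'(2) by metis
    then have "real (hamming_weight n (?C x)) \<le> real (hamming_weight n v)"
      using weight1_ge(1)[OF q_gt1 card_gt1 delta_pos] x(2) by simp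
    then show "hamming_weight n (?C x) \<le> hamming_weight n v" by simp
  qed simp
  then show ?thesis using x(2) by simp
qed

text \<open>Of the \<open>(t ^ 2 + 5 * t) / 2\<close> pairs, \<open>(1, 1)\<close> drops out because
  its frequency is 0; this accounts for the -2.\<close>

lemma card_weights_trace_code:
  assumes "t \<ge> 1"
  shows "real (card (hamming_weight n ` trace_code \<iota> m \<gamma> n t as - {0})) \<le> ((real t)\<^sup>2 + 5 * real t - 2) / 2"
proof -
  let ?P = "{(k, u). 1 \<le> k \<and> k \<le> t \<and> u \<le> k + (1::nat)}"
  let ?W = "hamming_weight n ` trace_code \<iota> m \<gamma> n t as - {0}"
  have fin: "finite ?P" by (rule finite_subset[of _ "{..t} \<times> {..t+1}"]) auto
  have "real ` ?W \<subseteq> (\<lambda>(k, u). weight1 q (CARD('r)) t \<delta> k u) ` (?P - {(1, 1)})"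
  proof
    fix w assume "w \<in> real ` ?W"
    then obtain x where x: "x \<in> tuples t" "w = real (hamming_weight n (codeword \<iota> m \<gamma> n t as x))"
      "hamming_weight n (codeword \<iota> m \<gamma> n t as x) \<noteq> 0"
      by (auto simp: trace_code_def)
    obtain k u where ku: "1 \<le> k" "k \<le> t" "u \<le> k + 1" "w = weight1 q (CARD('r)) t \<delta> k u"
      "freq (CARD('r)) t k u \<noteq> 0"
      using weight_occurs[OF x(1,3)] unfolding x(2) by metis
    then have "(k, u) \<in> ?P - {(1, 1)}" using freq_1_1 by auto
    then show "w \<in> (\<lambda>(k, u). weight1 q (CARD('r)) t \<delta> k u) ` (?P - {(1, 1)})"
      using ku(4) by (intro image_eqI[of _ _ "(k, u)"]) auto
  qed
  then have "card (real ` ?W) \<le> card (?P - {(1, 1)})"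
    using fin by (meson card_image_le card_mono finite_Diff finite_imageI order.trans)
  also have "card (real ` ?W) = card ?W" by (rule card_image) simp
  also have "card (?P - {(1, 1)}) = card ?P - 1" using assms by (subst card_Diff_singleton) auto
  \<comment> \<open>\<open>?P\<close> is nonempty for \<open>t \<ge> 1\<close>, so the natural
    subtraction of 1 is exact.\<close>
  finally have "2 * (real (card ?W) + 1) \<le> 2 * real (card ?P)"
    using assms fin card_0_eq[OF fin] by (cases "card ?P") auto
  also have "\<dots> = real (2 * card ?P)" by simp
  also have "\<dots> = (real t)\<^sup>2 + 5 * real t" unfolding card_index_pairs by simp
  finally show ?thesis by simp
qed

end

text \<open>The quotient is the sum of \<open>q ^ i\<close> for \<open>i < m\<close>: for even
  \<open>q\<close> it is odd, for odd \<open>q\<close> it has the parity of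
  \<open>m\<close>.\<close>

lemma even_geometric_sum:
  fixes q m :: nat
  assumes "q > 1" "m \<ge> 1" "even ((q ^ m - 1) div (q - 1))"
  shows "odd q" "even m"
proof -
  have "int (q ^ m - 1) = int (q - 1) * int (\<Sum>i<m. q ^ i)"
    using assms(1) power_diff_1_eq[of "int q" m] by (simp add: of_nat_diff)
  then have "q ^ m - 1 = (q - 1) * (\<Sum>i<m. q ^ i)" by (simp only: of_nat_mult[symmetric] of_nat_eq_iff)
  then have even: "even (\<Sum>i<m. q ^ i)" using assms by simp
  show "odd q"
  proof
    assume "even q"
    then have "odd (\<Sum>i<Suc k. q ^ i)" for k by (induction k) auto
    moreover have "m = Suc (m - 1)" using assms(2) by simp
    ultimately show False using even by metis
  qed
  then have "even (\<Sum>i<m. q ^ i) \<longleftrightarrow> even m" by (induction m) auto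
  with even show "even m" by simp
qed

theorem theorem1:
  fixes p s m q r e t \<delta> n :: nat
    and a :: int
    and \<Delta> as :: "nat \<Rightarrow> int"
    and \<iota> :: "'q::{field,finite} \<Rightarrow> 'r::{field,finite}"
    and \<gamma> :: 'r
  assumes "prime p" and "s \<ge> 1" and "m \<ge> 1" and "q = p ^ s" and "r = q ^ m"
    and "CARD('q) = q" and "CARD('r) = r" and "field_embedding \<iota>"
    and "generates_units \<gamma>"
    and "e \<ge> t" and "t \<ge> 2" and "e dvd r - 1"
    and "\<not> [a = 0] (mod int (r - 1))"
    and "\<forall>i\<in>{1..t}. \<forall>j\<in>{1..t}. i \<noteq> j \<longrightarrow> \<not> [\<Delta> i = \<Delta> j] (mod int e)"
    and "Gcd (insert (int e) ((\<lambda>i. \<Delta> i - \<Delta> 1) ` {2..t})) = 1"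
    and "\<forall>i\<in>{1..t}. [as i = a + int ((r - 1) div e) * \<Delta> i] (mod int (r - 1))"
    and "\<forall>i\<in>{1..t}. degree (minimal_poly \<iota> (\<gamma> powi (- as i))) = m"
    and "inj_on (\<lambda>i. minimal_poly \<iota> (\<gamma> powi (- as i))) {1..t}"
    and "int \<delta> = Gcd (insert (int (r - 1)) (as ` {1..t}))"
    and "n = (r - 1) div \<delta>"
    and "gcd (int ((r - 1) div (q - 1))) (a * int e) = 2"
    and "t = e - 1"
    and "e dvd q ^ (m div 2) - 1"
    and "2 dvd a"
  shows "cyclic_code n (t * m) (trace_code \<iota> m \<gamma> n t as)
    \<and> real (min_distance n (trace_code \<iota> m \<gamma> n t as))
        = 2 * (real q - 1) * (real r - sqrt (real r)) / ((real t + 1) * real q * real \<delta>)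
    \<and> real (card (hamming_weight n ` trace_code \<iota> m \<gamma> n t as - {0}))
        \<le> ((real t)\<^sup>2 + 5 * real t - 2) / 2
    \<and> card {x \<in> tuples t. hamming_weight n (codeword \<iota> m \<gamma> n t as x) = 0} = 1
    \<and> ([q = 1] (mod 4) \<longrightarrow>
        (\<forall>w::real. w > 0 \<longrightarrow>
          real (card {x \<in> tuples t. real (hamming_weight n (codeword \<iota> m \<gamma> n t as x)) = w})
          = (\<Sum>(k, u) | 1 \<le> k \<and> k \<le> t \<and> u \<le> k + 1 \<and> weight1 q r t \<delta> k u = w. freq r t k u)))
    \<and> ([q = 3] (mod 4) \<longrightarrow>
        (\<forall>w::real. w > 0 \<longrightarrow>
          real (card {x \<in> tuples t. real (hamming_weight n (codeword \<iota> m \<gamma> n t as x)) = w})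
          = (\<Sum>(k, u) | 1 \<le> k \<and> k \<le> t \<and> u \<le> k + 1 \<and> weight3 q m r t \<delta> k u = w. freq r t k u)))"
proof -
  have q: "q > 1"
    using assms(1,2,4) by (metis one_less_power prime_gt_1_nat less_le_trans zero_less_one)
  have r: "r > 1" unfolding assms(5) using q assms(3) by (intro one_less_power) auto
  let ?k = "(q ^ m - 1) div (q - 1)"
  \<comment> \<open>N = 2 makes the index even, which in turn makes \<open>q\<close> odd and
    \<open>m\<close> even.\<close>
  have "2 dvd int ?k" using assms(21) unfolding assms(5) by (metis gcd_dvd1)
  then have even_k: "even ?k" by simp
  note odd_q = even_geometric_sum(1)[OF q assms(3) even_k]
  note even_m = even_geometric_sum(2)[OF q assms(3) even_k]
  \<comment> \<open>The square root of \<open>r\<close>, an integer because \<open>m\<close> is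
    even; being odd, it makes \<open>r - 1\<close> divisible by 4.\<close>
  define Q where "Q = q ^ (m div 2)"
  have "r = q ^ (m div 2 * 2)" using assms(5) even_m by simp
  then have r_Q: "r = Q * Q" by (simp only: Q_def power_mult power2_eq_square)
  have "odd Q" using odd_q by (simp add: Q_def)
  then obtain c where c: "Q = 2 * c + 1" by (rule oddE)
  have r1: "r - 1 = (Q - 1) * (Q + 1)" by (simp add: r_Q algebra_simps)
  have r4: "r - 1 = 4 * (c * (c + 1))" by (simp add: r_Q c algebra_simps)
  have e: "e = t + 1" using assms(11,22) by simp
  obtain b where b: "Q - 1 = e * b" using assms(23) unfolding Q_def by (rule dvdE)
  \<comment> \<open>As \<open>e\<close> divides \<open>Q - 1\<close>, the quotient
    \<open>(r - 1) div e\<close> keeps the even factor \<open>Q + 1\<close>; this makes \<beta> a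
    square.\<close>
  have "r - 1 = e * (b * (Q + 1))" unfolding r1 b by (simp only: mult.assoc)
  moreover have "e > 0" using e by simp
  ultimately have "(r - 1) div e = b * (Q + 1)" by simp
  then have even_L: "even ((r - 1) div e)" using \<open>odd Q\<close> by simp
  interpret almost_full_trace_code \<gamma> "int (r - 1)" \<iota> p s m q e t \<delta> n "(r - 1) div e" a \<Delta> as
  proof unfold_locales
    show "4 dvd CARD('r) - 1" unfolding assms(7) r4 by simp
    show "even ((CARD('r) - 1) div (q - 1))" using even_k by (simp add: assms(5,7))
    show "CARD('r) - 1 = (r - 1) div e * e" using assms(12) by (simp add: assms(7))
    show "gcd (int ((CARD('r) - 1) div (q - 1))) (a * int e) = 2" using assms(21) by (simp only: assms(7))
    show "int (r - 1) = int (CARD('r) - 1)" by (simp only: assms(7))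
    show "CARD('r) = q ^ m" using assms(7) unfolding assms(5) .
    show "n = (CARD('r) - 1) div \<delta>" unfolding assms(7) by (rule assms(20))
  qed (rule assms e even_L)+
  have dist: "real (card {x \<in> tuples t. real (hamming_weight n (codeword \<iota> m \<gamma> n t as x)) = w})
      = (\<Sum>(k, u) | 1 \<le> k \<and> k \<le> t \<and> u \<le> k + 1 \<and> weight1 q r t \<delta> k u = w. freq r t k u)"
    if "w > 0" for w
    using weight_distribution[OF that] by (simp only: assms(7))
  have t1: "t \<ge> 1" using assms(11) by simp
  show ?thesis
  proof (intro conjI impI allI)
    show "cyclic_code n (t * m) (trace_code \<iota> m \<gamma> n t as)" by (rule cyclic_trace_code)
    show "real (min_distance n (trace_code \<iota> m \<gamma> n t as))
        = 2 * (real q - 1) * (real r - sqrt (real r)) / ((real t + 1) * real q * real \<delta>)"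
      using min_distance_trace_code[OF t1] by (simp only: assms(7) weight1_1_0)
    show "real (card (hamming_weight n ` trace_code \<iota> m \<gamma> n t as - {0}))
        \<le> ((real t)\<^sup>2 + 5 * real t - 2) / 2"
      by (rule card_weights_trace_code[OF t1])
    show "card {x \<in> tuples t. hamming_weight n (codeword \<iota> m \<gamma> n t as x) = 0} = 1"
      unfolding zero_weight_tuples by simp
  qed (simp_all only: dist weight3_sum_eq)
qed

end
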